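(* There is a fixed finitely generated submonoid $M$ of the wreath product $\mathbb{Z}\wr\mathbb{Z}$ with an undecidable membership problem.
   Context: Wreath product: for groups $G$ and $H$, let $H^{(G)}$ be the group of all mappings $f\colon G\to H$ with $f(a)=1_H$ for all but finitely many $a\in G$, with pointwise multiplication. $G$ acts on $H^{(G)}$ by $(gf)(a)=f(g^{-1}a)$. The wreath product $H\wr G$ is the semidirect product $H^{(G)}\rtimes G$: its elements are the pairs $(f,g)$ with $f\in H^{(G)}$, $g\in G$, and $(f_1,g_1)(f_2,g_2)=(f,g_1g_2)$ where $f(a)=f_1(a)f_2(g_1^{-1}a)$. Membership problem for a fixed finitely generated submonoid $M$ of a finitely generated group $G$: given an element $g\in G$, represented as a word over a fixed finite generating set of $G$ closed under inverses, decide whether $g\in M$. ($M$ is not part of the input.) *)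

theory Defs
  imports "HOL.Hull" "HOL-Algebra.Product_Groups" "HOL-Library.Nat_Bijection"
begin

section \<open>Wreath products\<close>

text \<open>The base group of \<open>H \<wr> G\<close> is the direct sum of copies of \<open>H\<close> indexed by the elements
  of \<open>G\<close>, that is, the finitely supported functions from \<open>G\<close> to \<open>H\<close>. As usual for function spaces
  with a carrier set, these are extensional: they are \<open>undefined\<close> outside \<open>carrier G\<close>.\<close>

definition wreath_product ::
    "('h, 'b) monoid_scheme \<Rightarrow> ('g, 'c) monoid_scheme \<Rightarrow> (('g \<Rightarrow> 'h) \<times> 'g) monoid"
    (infixr \<open>\<wr>\<close> 80)
  where "H \<wr> G =
    \<lparr>carrier = carrier (sum_group (carrier G) (\<lambda>_. H)) \<times> carrier G,
     monoid.mult = (\<lambda>(f1, g1) (f2, g2).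
       (\<lambda>a\<in>carrier G. f1 a \<otimes>\<^bsub>H\<^esub> f2 (inv\<^bsub>G\<^esub> g1 \<otimes>\<^bsub>G\<^esub> a), g1 \<otimes>\<^bsub>G\<^esub> g2)),
     one = (\<lambda>a\<in>carrier G. \<one>\<^bsub>H\<^esub>, \<one>\<^bsub>G\<^esub>)\<rparr>"

lemma carrier_wreath_product:
  assumes "group H"
  shows "carrier (H \<wr> G) =
    {f \<in> carrier G \<rightarrow>\<^sub>E carrier H. finite {a \<in> carrier G. f a \<noteq> \<one>\<^bsub>H\<^esub>}} \<times> carrier G"
  by (simp add: wreath_product_def carrier_sum_group assms)

lemma mult_wreath_product:
  "(f1, g1) \<otimes>\<^bsub>H \<wr> G\<^esub> (f2, g2) =
    (\<lambda>a\<in>carrier G. f1 a \<otimes>\<^bsub>H\<^esub> f2 (inv\<^bsub>G\<^esub> g1 \<otimes>\<^bsub>G\<^esub> a), g1 \<otimes>\<^bsub>G\<^esub> g2)"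
  by (simp add: wreath_product_def)

lemma one_wreath_product: "\<one>\<^bsub>H \<wr> G\<^esub> = (\<lambda>a\<in>carrier G. \<one>\<^bsub>H\<^esub>, \<one>\<^bsub>G\<^esub>)"
  by (simp add: wreath_product_def)

lemma group_wreath_product:
  assumes H: "group H" and G: "group G"
  shows "group (H \<wr> G)"
proof -
  interpret H: group H by fact
  interpret G: group G by fact
  have shift: "finite {a \<in> carrier G. f (g \<otimes>\<^bsub>G\<^esub> a) \<noteq> \<one>\<^bsub>H\<^esub>}"
    if fin: "finite {a \<in> carrier G. f a \<noteq> \<one>\<^bsub>H\<^esub>}" and g: "g \<in> carrier G" for f g
  proof (rule finite_subset)
    show "{a \<in> carrier G. f (g \<otimes>\<^bsub>G\<^esub> a) \<noteq> \<one>\<^bsub>H\<^esub>}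
        \<subseteq> (\<lambda>a. inv\<^bsub>G\<^esub> g \<otimes>\<^bsub>G\<^esub> a) ` {a \<in> carrier G. f a \<noteq> \<one>\<^bsub>H\<^esub>}"
    proof
      fix a assume a: "a \<in> {a \<in> carrier G. f (g \<otimes>\<^bsub>G\<^esub> a) \<noteq> \<one>\<^bsub>H\<^esub>}"
      then have "a = inv\<^bsub>G\<^esub> g \<otimes>\<^bsub>G\<^esub> (g \<otimes>\<^bsub>G\<^esub> a)"
        using g by (simp add: G.m_assoc [symmetric])
      moreover have "g \<otimes>\<^bsub>G\<^esub> a \<in> {a \<in> carrier G. f a \<noteq> \<one>\<^bsub>H\<^esub>}"
        using a g by simp
      ultimately show "a \<in> (\<lambda>a. inv\<^bsub>G\<^esub> g \<otimes>\<^bsub>G\<^esub> a) ` {a \<in> carrier G. f a \<noteq> \<one>\<^bsub>H\<^esub>}"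
        by blast
    qed
  qed (use fin in simp)
  show ?thesis
  proof (rule groupI)
    fix x y assume "x \<in> carrier (H \<wr> G)" "y \<in> carrier (H \<wr> G)"
    then obtain f1 g1 f2 g2 where eq: "x = (f1, g1)" "y = (f2, g2)"
      and f1: "f1 \<in> carrier G \<rightarrow>\<^sub>E carrier H" "finite {a \<in> carrier G. f1 a \<noteq> \<one>\<^bsub>H\<^esub>}"
      and f2: "f2 \<in> carrier G \<rightarrow>\<^sub>E carrier H" "finite {a \<in> carrier G. f2 a \<noteq> \<one>\<^bsub>H\<^esub>}"
      and g: "g1 \<in> carrier G" "g2 \<in> carrier G"
      by (auto simp: carrier_wreath_product H)
    let ?f = "\<lambda>a\<in>carrier G. f1 a \<otimes>\<^bsub>H\<^esub> f2 (inv\<^bsub>G\<^esub> g1 \<otimes>\<^bsub>G\<^esub> a)"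
    have "{a \<in> carrier G. ?f a \<noteq> \<one>\<^bsub>H\<^esub>} \<subseteq> {a \<in> carrier G. f1 a \<noteq> \<one>\<^bsub>H\<^esub>}
        \<union> {a \<in> carrier G. f2 (inv\<^bsub>G\<^esub> g1 \<otimes>\<^bsub>G\<^esub> a) \<noteq> \<one>\<^bsub>H\<^esub>}"
      by auto
    then have "finite {a \<in> carrier G. ?f a \<noteq> \<one>\<^bsub>H\<^esub>}"
      by (rule finite_subset) (use f1 f2 g shift in simp)
    moreover have "?f \<in> carrier G \<rightarrow>\<^sub>E carrier H"
      using f1(1) f2(1) g by (simp add: PiE_iff)
    ultimately show "x \<otimes>\<^bsub>H \<wr> G\<^esub> y \<in> carrier (H \<wr> G)"
      using g unfolding eq mult_wreath_product carrier_wreath_product [OF H] by simp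
  next
    show "\<one>\<^bsub>H \<wr> G\<^esub> \<in> carrier (H \<wr> G)"
      by (simp add: one_wreath_product carrier_wreath_product H cong: conj_cong)
  next
    fix x y z
    assume "x \<in> carrier (H \<wr> G)" "y \<in> carrier (H \<wr> G)" "z \<in> carrier (H \<wr> G)"
    then show "x \<otimes>\<^bsub>H \<wr> G\<^esub> y \<otimes>\<^bsub>H \<wr> G\<^esub> z = x \<otimes>\<^bsub>H \<wr> G\<^esub> (y \<otimes>\<^bsub>H \<wr> G\<^esub> z)"
      by (auto simp: carrier_wreath_product H mult_wreath_product PiE_iff fun_eq_iff
          H.m_assoc G.m_assoc G.inv_mult_group)
  next
    fix x assume "x \<in> carrier (H \<wr> G)"
    then obtain f g where eq: "x = (f, g)"
      and f: "f \<in> carrier G \<rightarrow>\<^sub>E carrier H" "finite {a \<in> carrier G. f a \<noteq> \<one>\<^bsub>H\<^esub>}"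
      and g: "g \<in> carrier G"
      by (auto simp: carrier_wreath_product H)
    show "\<one>\<^bsub>H \<wr> G\<^esub> \<otimes>\<^bsub>H \<wr> G\<^esub> x = x"
      using f g by (auto simp: eq one_wreath_product mult_wreath_product PiE_iff extensional_def
          fun_eq_iff)
    let ?f = "\<lambda>a\<in>carrier G. inv\<^bsub>H\<^esub> (f (g \<otimes>\<^bsub>G\<^esub> a))"
    have "{a \<in> carrier G. ?f a \<noteq> \<one>\<^bsub>H\<^esub>} \<subseteq> {a \<in> carrier G. f (g \<otimes>\<^bsub>G\<^esub> a) \<noteq> \<one>\<^bsub>H\<^esub>}"
      by auto
    then have "finite {a \<in> carrier G. ?f a \<noteq> \<one>\<^bsub>H\<^esub>}"
      by (rule finite_subset) (use f g shift in simp)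
    moreover have "?f \<in> carrier G \<rightarrow>\<^sub>E carrier H"
      using f(1) g by (simp add: PiE_iff)
    ultimately have "(?f, inv\<^bsub>G\<^esub> g) \<in> carrier (H \<wr> G)"
      using g unfolding carrier_wreath_product [OF H] by simp
    moreover have "(?f, inv\<^bsub>G\<^esub> g) \<otimes>\<^bsub>H \<wr> G\<^esub> x = \<one>\<^bsub>H \<wr> G\<^esub>"
      using f(1) g by (auto simp: eq one_wreath_product mult_wreath_product PiE_iff fun_eq_iff)
    ultimately show "\<exists>y\<in>carrier (H \<wr> G). y \<otimes>\<^bsub>H \<wr> G\<^esub> x = \<one>\<^bsub>H \<wr> G\<^esub>"
      by blast
  qed
qed


section \<open>Partial recursive functions and decidable languages\<close>

text \<open>Codes for Kleene's partial recursive functions on tuples of natural numbers;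
  \<open>eval f xs y\<close> means that \<open>f\<close> is defined at \<open>xs\<close> with value \<open>y\<close>. Ill-formed codes and
  argument lists of the wrong length simply have no value.\<close>

datatype recf = Zero | Succ | Proj nat | Comp recf "recf list" | PrimRec recf recf | Mu recf

inductive eval :: "recf \<Rightarrow> nat list \<Rightarrow> nat \<Rightarrow> bool" where
  Zero: "eval Zero xs 0"
| Succ: "eval Succ [x] (Suc x)"
| Proj: "i < length xs \<Longrightarrow> eval (Proj i) xs (xs ! i)"
| Comp: "list_all2 (\<lambda>g y. eval g xs y) gs ys \<Longrightarrow> eval f ys z \<Longrightarrow> eval (Comp f gs) xs z"
| PrimRec_0: "eval f xs y \<Longrightarrow> eval (PrimRec f g) (0 # xs) y"
| PrimRec_Suc: "eval (PrimRec f g) (n # xs) y \<Longrightarrow> eval g (n # y # xs) z \<Longrightarrow>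
    eval (PrimRec f g) (Suc n # xs) z"
| Mu: "eval f (n # xs) 0 \<Longrightarrow> (\<And>m. m < n \<Longrightarrow> \<exists>y. eval f (m # xs) (Suc y)) \<Longrightarrow> eval (Mu f) xs n"

lemma eval_functional: "eval f xs y \<Longrightarrow> eval f xs z \<Longrightarrow> y = z"
proof (induction arbitrary: z rule: eval.induct)
  case (Comp xs gs ys f z z')
  from Comp.prems obtain ys' where ys': "list_all2 (\<lambda>g y. eval g xs y) gs ys'" "eval f ys' z'"
    by cases auto
  have "ys = ys'"
    using Comp.IH(1) ys'(1) by (auto simp: list_all2_conv_all_nth intro: nth_equalityI)
  then show ?case
    using Comp.IH(2) ys'(2) by blast
next
  case (Mu f n xs z)
  from Mu.prems have z: "eval f (z # xs) 0" "\<And>m. m < z \<Longrightarrow> \<exists>y. eval f (m # xs) (Suc y)"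
    by (cases; blast)+
  have "\<not> z < n" "\<not> n < z"
    using Mu.IH z by fastforce+
  then show ?case by simp
next
  case (PrimRec_Suc f g n xs y z z')
  from PrimRec_Suc.prems obtain y' where "eval (PrimRec f g) (n # xs) y'" "eval g (n # y' # xs) z'"
    by cases auto
  then show ?case
    using PrimRec_Suc.IH by blast
next
  case (PrimRec_0 f xs y g)
  from PrimRec_0.prems have "eval f xs z"
    by cases auto
  then show ?case
    by (rule PrimRec_0.IH)
qed (erule eval.cases; simp)+

text \<open>Words over an alphabet with \<open>k\<close> letters are lists over \<open>{..<k}\<close>. They are fed to recursive
  functions through the computable bijection \<^const>\<open>list_encode\<close> between lists of natural numbers and
  natural numbers. The set of codes of such words is itself decidable, so the values of the
  decision procedure on other inputs are irrelevant.\<close>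

definition decidable_language :: "nat \<Rightarrow> nat list set \<Rightarrow> bool" where
  "decidable_language k L \<longleftrightarrow>
    (\<exists>f. \<forall>w \<in> lists {..<k}. eval f [list_encode w] (if w \<in> L then 1 else 0))"


section \<open>The membership problem for finitely generated submonoids\<close>

definition fin_gen_submonoid :: "('a, 'b) monoid_scheme \<Rightarrow> 'a set \<Rightarrow> bool" where
  "fin_gen_submonoid G M \<longleftrightarrow>
    (\<exists>S. finite S \<and> S \<subseteq> carrier G \<and> M = (\<lambda>N. submonoid N G) hull S)"

text \<open>An enumeration of a finite generating set closed under inverses; the letter \<open>i\<close> of a word
  stands for the generator \<open>gs ! i\<close>.\<close>

definition generator_list :: "('a, 'b) monoid_scheme \<Rightarrow> 'a list \<Rightarrow> bool" where
  "generator_list G gs \<longleftrightarrow> distinct gs \<and> set gs \<subseteq> carrier G \<and>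
    (\<forall>x\<in>set gs. inv\<^bsub>G\<^esub> x \<in> set gs) \<and> generate G (set gs) = carrier G"

definition word_value :: "('a, 'b) monoid_scheme \<Rightarrow> 'a list \<Rightarrow> nat list \<Rightarrow> 'a" where
  "word_value G gs w = foldr (\<lambda>i x. gs ! i \<otimes>\<^bsub>G\<^esub> x) w \<one>\<^bsub>G\<^esub>"

text \<open>Decidability of the membership problem does not depend on the choice of the finite
  generating set. Quantifying existentially here means that its negation asserts undecidability
  with respect to every finite generating set closed under inverses.\<close>

definition decidable_membership :: "('a, 'b) monoid_scheme \<Rightarrow> 'a set \<Rightarrow> bool" where
  "decidable_membership G M \<longleftrightarrow> (\<exists>gs. generator_list G gs \<and>
    decidable_language (length gs) {w \<in> lists {..<length gs}. word_value G gs w \<in> M})"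

text \<open>Since \<open>\<int> \<wr> \<int>\<close> is finitely generated, undecidability of membership is not vacuous there.\<close>

lemma ex_generator_list_integer_wreath: "\<exists>gs. generator_list (integer_group \<wr> integer_group) gs"
proof -
  let ?W = "integer_group \<wr> integer_group"
  interpret W: group ?W
    by (simp add: group_wreath_product)
  have carr: "carrier ?W = {f. finite {a. f a \<noteq> 0}} \<times> UNIV"
    by (simp add: carrier_wreath_product)
  have mult: "(f1, g1) \<otimes>\<^bsub>?W\<^esub> (f2, g2) = (\<lambda>a. f1 a + f2 (a - g1), g1 + g2)"
    for f1 f2 :: "int \<Rightarrow> int" and g1 g2
    by (simp add: mult_wreath_product restrict_def)
  have one: "\<one>\<^bsub>?W\<^esub> = (\<lambda>_. 0, 0)"
    by (simp add: one_wreath_product restrict_def)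
  define e :: "int \<Rightarrow> int \<Rightarrow> (int \<Rightarrow> int)" where "e = (\<lambda>k n a. if a = k then n else 0)"
  define S :: "((int \<Rightarrow> int) \<times> int) set"
    where "S = {(\<lambda>_. 0, 1), (\<lambda>_. 0, -1), (e 0 1, 0), (e 0 (-1), 0)}"
  have fin_e: "finite {a. e k n a \<noteq> 0}" for k n
    by (rule finite_subset [of _ "{k}"]) (auto simp: e_def)
  have S: "S \<subseteq> carrier ?W"
    using fin_e by (auto simp: S_def carr)
  have inv_t: "inv\<^bsub>?W\<^esub> (\<lambda>_. 0, k) = (\<lambda>_. 0, -k)" for k
    by (rule W.inv_equality) (auto simp: carr mult one)
  have inv_e: "inv\<^bsub>?W\<^esub> (e 0 k, 0) = (e 0 (-k), 0)" for k
    by (rule W.inv_equality) (use fin_e in \<open>auto simp: carr mult one e_def\<close>)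
  have closed: "inv\<^bsub>?W\<^esub> x \<in> S" if "x \<in> S" for x
    using that by (auto simp: S_def inv_t inv_e)
  interpret T: subgroup "generate ?W S" ?W
    by (rule W.generate_is_subgroup [OF S])
  have t_nat: "(\<lambda>_. 0, int n) \<in> generate ?W S" for n
  proof (induction n)
    case 0
    then show ?case using T.one_closed by (simp add: one)
  next
    case (Suc n)
    have "(\<lambda>_. 0, 1) \<in> generate ?W S" by (rule generate.incl) (simp add: S_def)
    from T.m_closed [OF this Suc] show ?case by (simp add: mult)
  qed
  have t: "(\<lambda>_. 0, k) \<in> generate ?W S" for k
  proof (cases "k \<ge> 0")
    case True
    then show ?thesis using t_nat [of "nat k"] by simp
  next
    case False
    then show ?thesis using T.m_inv_closed [OF t_nat [of "nat (-k)"]] by (simp add: inv_t)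
  qed
  have e_nat: "(e 0 (int n), 0) \<in> generate ?W S" for n
  proof (induction n)
    case 0
    then show ?case using T.one_closed by (simp add: one e_def)
  next
    case (Suc n)
    have "(e 0 1, 0) \<in> generate ?W S" by (rule generate.incl) (simp add: S_def)
    moreover have "(e 0 1, 0) \<otimes>\<^bsub>?W\<^esub> (e 0 (int n), 0) = (e 0 (int (Suc n)), 0)"
      by (auto simp: mult e_def)
    ultimately show ?case using T.m_closed Suc by metis
  qed
  have e_0: "(e 0 k, 0) \<in> generate ?W S" for k
  proof (cases "k \<ge> 0")
    case True
    then show ?thesis using e_nat [of "nat k"] by simp
  next
    case False
    then show ?thesis using T.m_inv_closed [OF e_nat [of "nat (-k)"]] by (simp add: inv_e)
  qed
  have e_gen: "(e k n, 0) \<in> generate ?W S" for k n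
  proof -
    have "(\<lambda>_. 0, k) \<otimes>\<^bsub>?W\<^esub> (e 0 n, 0) \<otimes>\<^bsub>?W\<^esub> (\<lambda>_. 0, -k) = (e k n, 0)"
      by (auto simp: mult e_def)
    then show ?thesis using T.m_closed [OF T.m_closed [OF t e_0] t] by metis
  qed
  have base: "(f, 0) \<in> generate ?W S" if "finite A" "{a. f a \<noteq> 0} \<subseteq> A" for f A
    using that
  proof (induction A arbitrary: f rule: finite_induct)
    case empty
    then have "f = (\<lambda>_. 0)" by auto
    then show ?case using T.one_closed by (simp add: one)
  next
    case (insert k A)
    have "(f(k := 0), 0) \<in> generate ?W S"
      by (rule insert.IH) (use insert.prems in auto)
    moreover have "(e k (f k), 0) \<otimes>\<^bsub>?W\<^esub> (f(k := 0), 0) = (f, 0)"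
      by (auto simp: mult e_def)
    ultimately show ?case using T.m_closed [OF e_gen] by metis
  qed
  have "x \<in> generate ?W S" if "x \<in> carrier ?W" for x
  proof -
    obtain f k where x: "x = (f, k)" "finite {a. f a \<noteq> 0}"
      using \<open>x \<in> carrier ?W\<close> by (auto simp: carr)
    have "(f, 0) \<otimes>\<^bsub>?W\<^esub> (\<lambda>_. 0, k) = x"
      by (simp add: mult x)
    then show ?thesis
      using T.m_closed [OF base [OF x(2) subset_refl] t] by metis
  qed
  then have "generate ?W S = carrier ?W"
    using T.subset by blast
  moreover obtain gs where "set gs = S" "distinct gs"
    using finite_distinct_list [of S] by (auto simp: S_def)
  ultimately show ?thesis
    using S closed unfolding generator_list_def by metis
qed

end

theory Submission
  imports Defs "HOL-Library.Countable" "HOL-Library.Infinite_Set" "HOL-Computational_Algebra.Primes"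
begin

text \<open>A finite set of affine rules \<open>m y + r \<rightarrow> a y + b\<close> on the natural numbers is simulated by a
  cursor that moves along \<open>\<int>\<close> and changes the integers stored there. When rule \<open>i\<close> turns \<open>x\<close> into
  \<open>x'\<close>, the generator \<open>Loop i\<close> is used \<open>y\<close> times to move \<open>m y\<close> from the cursor as \<open>a y\<close> to the cell at
  distance \<open>d\<^sub>i\<close>, and \<open>Jump i\<close> accounts for \<open>r\<close> and \<open>b\<close> and moves the cursor there. Cells are never
  visited again, so they must be left empty. As all distances lie in \<open>[L, 2L)\<close> and are distinct, a loop
  of another rule puts a positive amount into a cell that no later loop or jump can decrease. At value
  \<open>1\<close> the generator \<open>Stop\<close> moves the cursor into another residue class modulo \<open>4\<close>, in which \<open>Back\<close>
  takes it home without touching the computation. So membership in this submonoid is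
  reachability of \<open>1\<close> under affine rules.

  A nondeterministic counter program is turned into affine rules by storing the counters as
  exponents of primes, with one further prime for the current control state. Such programs
  compute all partial recursive functions, and one of them interprets any affine rule system coded
  by its input. If reachability were decidable for the rules of this interpreter, then
  diagonalisation would give a partial recursive function, hence a rule system, that contradicts its
  own description.\<close>

section \<open>Affine rule systems in the wreath product\<close>

abbreviation ZZ :: "((int \<Rightarrow> int) \<times> int) monoid" where
  "ZZ \<equiv> integer_group \<wr> integer_group"

lemma carrier_ZZ: "carrier ZZ = {f. finite {a. f a \<noteq> 0}} \<times> UNIV"
  by (simp add: carrier_wreath_product)

lemma mult_ZZ: "(f1, g1) \<otimes>\<^bsub>ZZ\<^esub> (f2, g2) = (\<lambda>a. f1 a + f2 (a - g1), g1 + g2)"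
  by (simp add: mult_wreath_product restrict_def)

lemma one_ZZ: "\<one>\<^bsub>ZZ\<^esub> = (\<lambda>_. 0, 0)"
  by (simp add: one_wreath_product restrict_def)

lemma group_ZZ: "group ZZ"
  by (simp add: group_wreath_product)

definition astep :: "(nat \<times> nat \<times> nat \<times> nat) set \<Rightarrow> nat rel" where
  "astep R = {(m * y + r, a * y + b) | m r a b y. (m, r, a, b) \<in> R}"

section \<open>Generated submonoids and linear functionals on finitely supported functions\<close>

lemma mem_hull_submonoid_iff:
  assumes G: "monoid G" and S: "S \<subseteq> carrier G"
  shows "x \<in> (\<lambda>N. submonoid N G) hull S \<longleftrightarrow>
    (\<exists>xs. set xs \<subseteq> S \<and> x = foldr (\<otimes>\<^bsub>G\<^esub>) xs \<one>\<^bsub>G\<^esub>)"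
proof -
  interpret monoid G by fact
  have carr: "foldr (\<otimes>\<^bsub>G\<^esub>) xs \<one>\<^bsub>G\<^esub> \<in> carrier G" if "set xs \<subseteq> S" for xs
    using that S by (induction xs) auto
  let ?P = "{foldr (\<otimes>\<^bsub>G\<^esub>) xs \<one>\<^bsub>G\<^esub> | xs. set xs \<subseteq> S}"
  have app: "foldr (\<otimes>\<^bsub>G\<^esub>) (xs @ ys) \<one>\<^bsub>G\<^esub> =
      foldr (\<otimes>\<^bsub>G\<^esub>) xs \<one>\<^bsub>G\<^esub> \<otimes>\<^bsub>G\<^esub> foldr (\<otimes>\<^bsub>G\<^esub>) ys \<one>\<^bsub>G\<^esub>"
    if "set xs \<subseteq> S" "set ys \<subseteq> S" for xs ys
    using that(1)
  proof (induction xs)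
    case (Cons a xs)
    then have "a \<in> carrier G" using S by auto
    with Cons show ?case using carr[of xs] carr[OF that(2)] by (simp add: m_assoc)
  qed (use carr[OF that(2)] in simp)
  have P: "submonoid ?P G"
  proof
    show "?P \<subseteq> carrier G" using carr by auto
    show "\<one>\<^bsub>G\<^esub> \<in> ?P" by (rule CollectI, rule exI[of _ "[]"]) simp
    fix u v assume "u \<in> ?P" "v \<in> ?P"
    then obtain xs ys where "set xs \<subseteq> S" "set ys \<subseteq> S" "u = foldr (\<otimes>\<^bsub>G\<^esub>) xs \<one>\<^bsub>G\<^esub>" "v = foldr (\<otimes>\<^bsub>G\<^esub>) ys \<one>\<^bsub>G\<^esub>"
      by auto
    then show "u \<otimes>\<^bsub>G\<^esub> v \<in> ?P"
      using app by (intro CollectI exI[of _ "xs @ ys"]) simp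
  qed
  have "S \<subseteq> ?P"
  proof
    fix u assume "u \<in> S"
    then show "u \<in> ?P" using S by (intro CollectI exI[of _ "[u]"]) auto
  qed
  then have 1: "(\<lambda>N. submonoid N G) hull S \<subseteq> ?P"
    using P by (rule hull_minimal)
  have "foldr (\<otimes>\<^bsub>G\<^esub>) xs \<one>\<^bsub>G\<^esub> \<in> N" if N: "submonoid N G" "S \<subseteq> N" and xs: "set xs \<subseteq> S" for N xs
    using xs N(2) by (induction xs) (auto intro: submonoid.m_closed[OF N(1)] submonoid.one_closed[OF N(1)])
  then have "?P \<subseteq> (\<lambda>N. submonoid N G) hull S"
    by (auto simp: hull_def)
  with 1 show ?thesis by auto
qed

definition delta :: "int \<Rightarrow> int \<Rightarrow> int" where
  "delta k p = (if p = k then 1 else 0)"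

text \<open>A linear functional on finitely supported functions. Suitable choices of
  \<open>w\<close> turn it into invariants that count how often a given letter occurs in a
  word.\<close>

definition weight :: "(int \<Rightarrow> int) \<Rightarrow> (int \<Rightarrow> int) \<Rightarrow> int" where
  "weight w f = (\<Sum>p | f p \<noteq> 0. w p * f p)"

lemma weight_superset: "finite A \<Longrightarrow> {p. f p \<noteq> 0} \<subseteq> A \<Longrightarrow> weight w f = (\<Sum>p\<in>A. w p * f p)"
  unfolding weight_def by (rule sum.mono_neutral_left) auto

lemma weight_add:
  assumes "finite {p. f p \<noteq> 0}" "finite {p. g p \<noteq> 0}"
  shows "weight w (\<lambda>p. f p + g p) = weight w f + weight w g"
proof -
  let ?A = "{p. f p \<noteq> 0} \<union> {p. g p \<noteq> 0}"
  have "finite ?A" using assms by simp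
  from weight_superset[OF this, of _ w] show ?thesis
    by (subst (1 2 3) weight_superset[of ?A]) (use assms in \<open>auto simp: sum.distrib algebra_simps\<close>)
qed

lemma finite_support_two: "finite {p. u * delta j (p - c) + v * delta k (p - c) \<noteq> (0::int)}"
  by (rule finite_subset[of _ "{c + j, c + k}"]) (auto simp: delta_def split: if_splits)

text \<open>Every generator changes at most two cells, so this evaluates a functional on a single
  letter used at cursor \<open>c\<close>. The case \<open>j = k\<close> is separate because both
  contributions then fall into one cell.\<close>

lemma weight_two:
  "weight w (\<lambda>p. u * delta j (p - c) + v * delta k (p - c)) = u * w (c + j) + v * w (c + k)"
proof (cases "j = k")
  case True
  then show ?thesis
    by (subst weight_superset[of "{c + j}"]) (auto simp: delta_def algebra_simps split: if_splits)
next
  case False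
  then show ?thesis
    by (subst weight_superset[of "{c + j, c + k}"]) (auto simp: delta_def algebra_simps split: if_splits)
qed

section \<open>Generators and the run of a word\<close>

datatype letter = Loop nat | Jump nat | Stop | Back

locale affine_system =
  fixes rs :: "(nat \<times> nat \<times> nat \<times> nat) list"
  assumes pos: "(m, r, a, b) \<in> set rs \<Longrightarrow> m > 0 \<and> a > 0"
begin

definition rm where "rm i = int (fst (rs ! i))"
definition rr where "rr i = int (fst (snd (rs ! i)))"
definition ra where "ra i = int (fst (snd (snd (rs ! i))))"
definition rb where "rb i = int (snd (snd (snd (rs ! i))))"

text \<open>The distances before scaling by \<open>4\<close> lie between \<open>L\<close> and \<open>2L\<close>, where \<open>L\<close> is the number of rules;
  hence a difference of two distances is smaller than any distance.\<close>

definition hop :: "nat \<Rightarrow> int" where "hop i = 4 * int (length rs + i)"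

lemma ra_pos: "i < length rs \<Longrightarrow> ra i > 0"
  using pos[of "fst (rs ! i)" "fst (snd (rs ! i))" "fst (snd (snd (rs ! i)))" "snd (snd (snd (rs ! i)))"]
  by (auto simp: ra_def)

lemma rb_nonneg: "rb i \<ge> 0"
  by (simp add: rb_def)

lemma astep_set_iff:
  "(x, x') \<in> astep (set rs) \<longleftrightarrow>
    (\<exists>i<length rs. \<exists>y. int x = rm i * int y + rr i \<and> int x' = ra i * int y + rb i)"
proof -
  have *: "int x = int m * int y + int r \<longleftrightarrow> x = m * y + r" for x m y r
    by (metis of_nat_add of_nat_eq_iff of_nat_mult)
  show ?thesis
    unfolding astep_def rm_def rr_def ra_def rb_def *
    by (force simp: in_set_conv_nth)
qed

text \<open>Before \<open>Stop\<close>, the cursor is at multiples of \<open>4\<close>: loops and jumps affect cells in class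
  \<open>0\<close> modulo \<open>4\<close>, and \<open>Back\<close> affects class \<open>1\<close>. Afterwards these become classes \<open>2\<close> and \<open>3\<close>.\<close>

fun eff1 :: "letter \<Rightarrow> int \<Rightarrow> int" where
  "eff1 (Loop i) = (\<lambda>p. - rm i * delta 0 p + ra i * delta (hop i) p)"
| "eff1 (Jump i) = (\<lambda>p. - rr i * delta 0 p + rb i * delta (hop i) p)"
| "eff1 Stop = (\<lambda>p. - 1 * delta 0 p + 1 * delta 3 p)"
| "eff1 Back = (\<lambda>p. - 1 * delta 1 p + 1 * delta (- 3) p)"

fun shift1 :: "letter \<Rightarrow> int" where
  "shift1 (Loop i) = 0"
| "shift1 (Jump i) = hop i"
| "shift1 Stop = 2"
| "shift1 Back = - 4"

definition letters :: "letter set" where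
  "letters = {Stop, Back} \<union> Loop ` {..<length rs} \<union> Jump ` {..<length rs}"

definition gen :: "letter \<Rightarrow> (int \<Rightarrow> int) \<times> int" where
  "gen l = (eff1 l, shift1 l)"

text \<open>For \<open>x = 1\<close> this is \<open>gen Stop\<close>; in general the amount taken
  from the origin is the value \<open>x\<close> at which the simulated computation starts.\<close>

definition target :: "nat \<Rightarrow> (int \<Rightarrow> int) \<times> int" where
  "target x = (\<lambda>p. - int x * delta 0 p + delta 3 p, 2)"

fun eff :: "int \<Rightarrow> letter list \<Rightarrow> int \<Rightarrow> int" where
  "eff c [] = (\<lambda>p. 0)"
| "eff c (l # ls) = (\<lambda>p. eff1 l (p - c) + eff (c + shift1 l) ls p)"

definition cur :: "int \<Rightarrow> letter list \<Rightarrow> int" where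
  "cur c ls = c + sum_list (map shift1 ls)"

lemma cur_simps [simp]: "cur c [] = c" "cur c (l # ls) = cur (c + shift1 l) ls"
  by (simp_all add: cur_def)

lemma eff_append: "eff c (xs @ ys) p = eff c xs p + eff (cur c xs) ys p"
  by (induction xs arbitrary: c) auto

lemma eff_shift: "eff (c + d) ls p = eff c ls (p - d)"
proof (induction ls arbitrary: c)
  case (Cons l ls)
  have "eff (c + d + shift1 l) ls p = eff (c + shift1 l) ls (p - d)"
    using Cons[of "c + shift1 l"] by (simp add: ac_simps)
  then show ?case by (simp add: algebra_simps)
qed simp

lemma cur_shift: "cur (c + d) ls = cur c ls + d"
  by (simp add: cur_def)

text \<open>The shift of the first letter acts on the remaining product by translating its run, so
  multiplying in the semidirect product amounts to starting the rest at the moved cursor.\<close>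

lemma foldr_gen: "foldr (\<otimes>\<^bsub>ZZ\<^esub>) (map gen ls) \<one>\<^bsub>ZZ\<^esub> = (eff 0 ls, cur 0 ls)"
proof (induction ls)
  case Nil
  then show ?case by (simp add: one_ZZ)
next
  case (Cons l ls)
  then show ?case
    using eff_shift[of 0 "shift1 l" ls] cur_shift[of 0 "shift1 l" ls]
    by (auto simp: gen_def mult_ZZ)
qed

lemma eff1_two: "\<exists>u j v k. eff1 l = (\<lambda>p. u * delta j p + v * delta k p)"
  by (cases l) (simp_all only: eff1.simps, blast+)

lemma finite_eff1: "finite {p. eff1 l (p - c) \<noteq> 0}"
proof -
  obtain u j v k where "eff1 l = (\<lambda>p. u * delta j p + v * delta k p)"
    using eff1_two by blast
  then show ?thesis using finite_support_two by simp
qed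

lemma finite_eff: "finite {p. eff c ls p \<noteq> 0}"
proof (induction ls arbitrary: c)
  case (Cons l ls)
  show ?case
    by (rule finite_subset[OF _ finite_UnI[OF finite_eff1[of l c] Cons[of "c + shift1 l"]]]) auto
qed simp

lemma weight_eff_Cons:
  "weight w (eff c (l # ls)) = weight w (\<lambda>p. eff1 l (p - c)) + weight w (eff (c + shift1 l) ls)"
  by (simp add: weight_add[OF finite_eff1 finite_eff])

definition monoid_gens where "monoid_gens = gen ` letters"

definition simulator where "simulator = (\<lambda>N. submonoid N ZZ) hull monoid_gens"

lemma gens_carrier: "monoid_gens \<subseteq> carrier ZZ"
  using finite_eff1[of _ 0] by (auto simp: monoid_gens_def gen_def carrier_ZZ)

lemma fin_gen_simulator: "fin_gen_submonoid ZZ simulator"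
  unfolding fin_gen_submonoid_def simulator_def
  by (intro exI[of _ monoid_gens] conjI gens_carrier refl) (auto simp: monoid_gens_def letters_def)

lemma mem_simulator_iff: "x \<in> simulator \<longleftrightarrow> (\<exists>ls. set ls \<subseteq> letters \<and> x = (eff 0 ls, cur 0 ls))"
proof -
  have "monoid ZZ" using group_ZZ by (rule group.is_monoid)
  note * = mem_hull_submonoid_iff[OF this gens_carrier]
  have "(\<exists>xs. set xs \<subseteq> monoid_gens \<and> P xs) \<longleftrightarrow> (\<exists>ls. set ls \<subseteq> letters \<and> P (map gen ls))" for P
  proof -
    have "lists monoid_gens = map gen ` lists letters"
      unfolding monoid_gens_def by (rule lists_image)
    then show ?thesis by (auto simp: in_lists_conv_set subset_iff set_eq_iff lists_eq_set image_iff)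
  qed
  then show ?thesis unfolding simulator_def * foldr_gen[symmetric] by simp
qed

section \<open>From rule derivations to words\<close>

lemma eff_replicate_Loop:
  "eff c (replicate y (Loop i)) p = int y * eff1 (Loop i) (p - c)"
  by (induction y) (simp_all add: algebra_simps)

lemma cur_replicate: "cur c (replicate y l) = c + int y * shift1 l"
  by (simp add: cur_def sum_list_replicate)

text \<open>Telescopes: each \<open>Back\<close> picks up the unit that the previous one put down,
  one cell right of the cursor, and carries it \<open>4\<close> cells further left.\<close>

lemma eff_replicate_Back:
  "eff c (replicate d Back) p = delta (c + 1 - 4 * int d) p - delta (c + 1) p"
proof (induction d arbitrary: c)
  case (Suc d)
  then show ?case by (auto simp: delta_def)
qed simp

lemma target_in_simulator_of_reach: "(x, 1) \<in> (astep (set rs))\<^sup>* \<Longrightarrow> target x \<in> simulator"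
proof (induction rule: converse_rtrancl_induct)
  case base
  show ?case unfolding mem_simulator_iff
    by (intro exI[of _ "[Stop]"]) (auto simp: letters_def target_def)
next
  case (step x x')
  obtain i y where i: "i < length rs" and x: "int x = rm i * int y + rr i" "int x' = ra i * int y + rb i"
    using step(1) by (auto simp: astep_set_iff)
  obtain ls where ls: "set ls \<subseteq> letters" "target x' = (eff 0 ls, cur 0 ls)"
    using step(3) by (auto simp: mem_simulator_iff)
  define d where "d = length rs + i"
  have eff_ls: "eff c ls p = - int x' * delta 0 (p - c) + delta 3 (p - c)" for c p
    using ls(2) eff_shift[of 0 c ls p] by (auto simp: target_def fun_eq_iff)
  have cur_ls: "cur c ls = c + 2" for c
    using ls(2) cur_shift[of 0 c ls] by (simp add: target_def)
  \<comment> \<open>Loops and jump take \<open>x\<close> from the origin and put \<open>x'\<close>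
    at \<open>hop i\<close>. Run from there, \<open>ls\<close> consumes \<open>x'\<close> and leaves
    the cursor at \<open>hop i + 2\<close> and a unit at \<open>hop i + 3\<close>. As
    \<open>hop i = 4 * d\<close>, the copies of \<open>Back\<close> bring these to \<open>2\<close>
    and \<open>3\<close>.\<close>
  let ?w = "replicate y (Loop i) @ Jump i # ls @ replicate d Back"
  have "eff 0 ?w p = - int x * delta 0 p + delta 3 p" for p
    unfolding eff_append cur_replicate eff_replicate_Loop eff.simps eff_ls eff_replicate_Back cur_ls
    by (simp add: hop_def d_def[symmetric] x) (simp add: delta_def algebra_simps)
  moreover have "cur 0 ?w = 2"
    using cur_ls[of 0]
    by (simp add: cur_def sum_list_replicate hop_def d_def[symmetric])
  ultimately have "target x = (eff 0 ?w, cur 0 ?w)"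
    by (simp add: target_def fun_eq_iff)
  moreover have "set ?w \<subseteq> letters"
    using i ls(1) by (auto simp: letters_def)
  ultimately show ?case unfolding mem_simulator_iff by blast
qed

section \<open>From words to rule derivations\<close>

abbreviation forward :: "letter set" where
  "forward \<equiv> Loop ` {..<length rs} \<union> Jump ` {..<length rs}"

lemma cur_forward:
  "set ls \<subseteq> forward \<Longrightarrow> cur c ls = c \<or> cur c ls \<ge> c + 4 * int (length rs)"
proof (induction ls arbitrary: c)
  case (Cons l ls)
  then have IH: "cur c' ls = c' \<or> cur c' ls \<ge> c' + 4 * int (length rs)" for c' by simp
  show ?case
    using Cons.prems IH[of c] IH[of "c + shift1 l"] by (cases l) (auto simp: hop_def)
qed simp

lemma eff_forward_left: "set ls \<subseteq> forward \<Longrightarrow> p < c \<Longrightarrow> eff c ls p = 0"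
proof (induction ls arbitrary: c)
  case (Cons l ls)
  then show ?case by (auto simp: hop_def delta_def)
qed simp

text \<open>Loops and jumps deposit at least \<open>4 * int (length rs)\<close> cells ahead of the
  cursor, and the first jump carries the cursor past \<open>p\<close>. Hence nothing is ever
  withdrawn at \<open>p\<close>.\<close>

lemma eff_forward_gap:
  "set ls \<subseteq> forward \<Longrightarrow> c < p \<Longrightarrow> p < c + 4 * int (length rs) \<Longrightarrow> eff c ls p \<ge> 0"
proof (induction ls arbitrary: c)
  case (Cons l ls)
  then show ?case
  proof (cases l)
    case (Loop i)
    then have "ra i > 0" using Cons.prems ra_pos by auto
    then show ?thesis using Loop Cons by (auto simp: delta_def)
  next
    case (Jump i)
    then have "eff (c + hop i) ls p = 0"
      using Cons.prems by (intro eff_forward_left) (auto simp: hop_def)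
    then show ?thesis using Jump Cons by (auto simp: delta_def hop_def)
  qed auto
qed simp

text \<open>Here \<open>n i\<close> counts the loops of rule \<open>i\<close> that were applied since the cursor last jumped, and
  \<open>x\<close> is what they have left at the cursor.\<close>

lemma reach_of_forward:
  assumes "set ls \<subseteq> forward"
    and "\<And>p. eff 0 ls p = delta (cur 0 ls) p - x * delta 0 p
              - (\<Sum>i<length rs. n i * ra i * delta (hop i) p)"
    and "\<And>i. n i \<ge> 0"
    and "int z = x + (\<Sum>i<length rs. n i * rm i)"
  shows "(z, 1) \<in> (astep (set rs))\<^sup>*"
  using assms
proof (induction ls arbitrary: x n z)
  \<comment> \<open>With no letters left, the cells \<open>hop j\<close> force all counts to vanish,
    and cell \<open>0\<close> forces \<open>x = 1\<close>.\<close>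
  case Nil
  let ?L = "length rs"
  have at: "(\<Sum>i<?L. n i * ra i * delta (hop i) (hop j)) = n j * ra j" if "j < ?L" for j
  proof -
    have "(\<Sum>i<?L. n i * ra i * delta (hop i) (hop j)) = (\<Sum>i<?L. if i = j then n j * ra j else 0)"
      by (rule sum.cong) (auto simp: delta_def hop_def)
    then show ?thesis using that by simp
  qed
  have n0: "n j = 0" if "j < ?L" for j
  proof -
    have "hop j > 0" using that by (simp add: hop_def)
    then have "n j * ra j = 0"
      using Nil(2)[of "hop j"] at[OF that] by (simp add: delta_def)
    then show ?thesis using ra_pos[OF that] by simp
  qed
  have "x = 1" using Nil(2)[of 0] n0 by (simp add: delta_def)
  then have "z = 1" using Nil(4) n0 by simp
  then show ?case by simp
next
  case (Cons l ls)
  let ?L = "length rs"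
  have ls: "set ls \<subseteq> forward" using Cons.prems by simp
  have at: "(\<Sum>i<?L. n i * ra i * delta (hop i) (hop j)) = n j * ra j" if "j < ?L" for j
  proof -
    have "(\<Sum>i<?L. n i * ra i * delta (hop i) (hop j)) = (\<Sum>i<?L. if i = j then n j * ra j else 0)"
      by (rule sum.cong) (auto simp: delta_def hop_def)
    then show ?thesis using that by simp
  qed
  consider (L) k where "l = Loop k" "k < ?L" | (J) k where "l = Jump k" "k < ?L"
    using Cons.prems(1) by auto
  then show ?case
  proof cases
    case L
    \<comment> \<open>A loop moves \<open>rm k\<close> from the open balance \<open>x\<close> into
      the count of rule \<open>k\<close>; the represented number \<open>z\<close> stays the
      same.\<close>
    let ?n = "n(k := n k + 1)"
    have upd: "(\<Sum>i<?L. ?n i * g i) = (\<Sum>i<?L. n i * g i) + g k" for g :: "nat \<Rightarrow> int"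
    proof -
      have "(\<Sum>i<?L. ?n i * g i) = (\<Sum>i<?L. n i * g i + (if i = k then g k else 0))"
        by (rule sum.cong) (auto simp: algebra_simps)
      then show ?thesis using L(2) by (simp add: sum.distrib)
    qed
    show ?thesis
    proof (rule Cons.IH[OF ls, where n = ?n and x = "x - rm k"])
      show "eff 0 ls p = delta (cur 0 ls) p - (x - rm k) * delta 0 p -
          (\<Sum>i<?L. ?n i * ra i * delta (hop i) p)" for p
        using Cons.prems(2)[of p] upd[of "\<lambda>i. ra i * delta (hop i) p"]
        by (simp add: L algebra_simps)
      show "?n i \<ge> 0" for i using Cons.prems(3)[of i] Cons.prems(3)[of k] by simp
      show "int z = x - rm k + (\<Sum>i<?L. ?n i * rm i)"
        using Cons.prems(4) upd[of rm] by simp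
    qed
  next
    case J
    have dk: "hop k > 0" "hop k \<ge> 4 * int ?L" using J by (auto simp: hop_def)
    have cur: "cur (hop k) ls = hop k \<or> cur (hop k) ls \<ge> hop k + 4 * int ?L"
      using cur_forward[OF ls] .
    have E: "- rr k * delta 0 p + rb k * delta (hop k) p + eff (hop k) ls p =
      delta (cur (hop k) ls) p - x * delta 0 p - (\<Sum>i<?L. n i * ra i * delta (hop i) p)" for p
      using Cons.prems(2)[of p] by (simp add: J)
    have "(\<Sum>i<?L. n i * ra i * delta (hop i) 0) = 0"
      by (rule sum.neutral) (auto simp: delta_def hop_def)
    \<comment> \<open>After the jump no letter reaches cell \<open>0\<close>, so the jump must
      settle its balance exactly.\<close>
    then have x: "x = rr k"
      using E[of 0] dk cur eff_forward_left[OF ls, of 0 "hop k"] by (auto simp: delta_def)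
    \<comment> \<open>Loops of another rule would have left a positive amount at
      \<open>hop j\<close>. The jump does not touch that cell, the rest of the word cannot lower it,
      and the cursor does not end there.\<close>
    have n0: "n j = 0" if j: "j < ?L" "j \<noteq> k" for j
    proof -
      have d: "hop j \<noteq> hop k" "hop j > 0" "hop j < hop k + 4 * int ?L"
        using j J by (auto simp: hop_def)
      have "eff (hop k) ls (hop j) \<ge> 0"
      proof (cases "hop j < hop k")
        case True
        then show ?thesis using eff_forward_left[OF ls] by simp
      next
        case False
        then show ?thesis using eff_forward_gap[OF ls] d by simp
      qed
      moreover have "cur (hop k) ls \<noteq> hop j"
        using cur d by auto
      ultimately have "n j * ra j \<le> 0"
        using E[of "hop j"] at[OF j(1)] d by (auto simp: delta_def)
      then show ?thesis
        using ra_pos[OF j(1)] Cons.prems(3)[of j] by (auto simp: mult_le_0_iff)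
    qed
    have single: "(\<Sum>i<?L. n i * g i) = n k * g k" for g :: "nat \<Rightarrow> int"
    proof -
      have "(\<Sum>i<?L. n i * g i) = (\<Sum>i<?L. if i = k then n k * g k else 0)"
        by (rule sum.cong) (auto simp: n0)
      then show ?thesis using J(2) by simp
    qed
    \<comment> \<open>The amount lying at \<open>hop k\<close>. This cell becomes the new origin,
      where the induction hypothesis applies with all counts reset to zero.\<close>
    define z' where "z' = nat (ra k * n k + rb k)"
    have z': "int z' = ra k * n k + rb k"
      using ra_pos[OF J(2)] Cons.prems(3)[of k] rb_nonneg[of k] by (simp add: z'_def)
    have "(z', 1) \<in> (astep (set rs))\<^sup>*"
    proof (rule Cons.IH[OF ls, where n = "\<lambda>_. 0" and x = "int z'"])
      show "eff 0 ls p = delta (cur 0 ls) p - int z' * delta 0 p - (\<Sum>i<?L. 0 * ra i * delta (hop i) p)" for p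
        using E[of "p + hop k"] eff_shift[of 0 "hop k" ls "p + hop k"] cur_shift[of 0 "hop k" ls]
          single[of "\<lambda>i. ra i * delta (hop i) (p + hop k)"] x z'
        by (simp add: delta_def algebra_simps)
    qed auto
    moreover have "(z, z') \<in> astep (set rs)"
      unfolding astep_set_iff
    proof (rule exI[of _ k], rule conjI[OF J(2)], rule exI[of _ "nat (n k)"], rule conjI)
      show "int z = rm k * int (nat (n k)) + rr k"
        using Cons.prems(3)[of k] Cons.prems(4) single[of rm] x by (simp add: algebra_simps)
      show "int z' = ra k * int (nat (n k)) + rb k"
        using Cons.prems(3)[of k] z' by (simp add: algebra_simps)
    qed
    ultimately show ?thesis by (rule converse_rtrancl_into_rtrancl[rotated])
  qed
qed

lemma shift1_mod: "l \<noteq> Stop \<Longrightarrow> shift1 l mod 4 = 0"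
  by (cases l) (auto simp: hop_def)

text \<open>The sum over odd cells counts the occurrences of \<open>Stop\<close>; the weighted sum over class \<open>1\<close>
  modulo \<open>4\<close> counts the occurrences of \<open>Back\<close> before \<open>Stop\<close>, as each of them moves a unit by \<open>-4\<close>.\<close>

lemma weight_odd_eff:
  "even c \<Longrightarrow> weight (\<lambda>p. of_bool (odd p)) (eff c ls) = int (count_list ls Stop)"
proof (induction ls arbitrary: c)
  case Nil
  then show ?case by (simp add: weight_def)
next
  case (Cons l ls)
  have "even (shift1 l)" by (cases l) (auto simp: hop_def)
  then have "weight (\<lambda>p. of_bool (odd p)) (eff (c + shift1 l) ls) = int (count_list ls Stop)"
    using Cons by simp
  moreover have "weight (\<lambda>p. of_bool (odd p)) (\<lambda>p. eff1 l (p - c)) = (if l = Stop then 1 else 0)"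
    by (cases l) (simp_all only: eff1.simps weight_two, use Cons.prems in \<open>auto simp: hop_def\<close>)
  ultimately show ?case by (simp add: weight_eff_Cons del: eff.simps)
qed

lemma weight_back_eff:
  "c mod 4 = 0 \<Longrightarrow> Stop \<notin> set ls \<Longrightarrow>
    weight (\<lambda>p. of_bool (p mod 4 = 1) * p) (eff c ls) = - 4 * int (count_list ls Back)"
proof (induction ls arbitrary: c)
  case Nil
  then show ?case by (simp add: weight_def)
next
  case (Cons l ls)
  have "(c + shift1 l) mod 4 = 0"
    using Cons.prems shift1_mod[of l] by (metis add_0 list.set_intros(1) mod_add_eq mod_0)
  then have "weight (\<lambda>p. of_bool (p mod 4 = 1) * p) (eff (c + shift1 l) ls) = - 4 * int (count_list ls Back)"
    using Cons by simp
  moreover have "weight (\<lambda>p. of_bool (p mod 4 = 1) * p) (\<lambda>p. eff1 l (p - c)) = (if l = Back then - 4 else 0)"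
  proof -
    obtain q where c: "c = 4 * q" using Cons.prems(1) by auto
    show ?thesis
      by (cases l; simp only: eff1.simps weight_two) (use Cons.prems in \<open>auto simp: hop_def c; presburger\<close>)+
  qed
  ultimately show ?case by (simp add: weight_eff_Cons del: eff.simps)
qed

lemma eff_odd_class:
  "c mod 4 = 2 \<Longrightarrow> Stop \<notin> set ls \<Longrightarrow> p mod 4 \<in> {0, 1} \<Longrightarrow> eff c ls p = 0"
proof (induction ls arbitrary: c)
  case (Cons l ls)
  have "(c + shift1 l) mod 4 = 2"
    using Cons.prems shift1_mod[of l] by (metis add_0_right list.set_intros(1) mod_add_eq mod_mod_trivial)
  then have "eff (c + shift1 l) ls p = 0" using Cons by simp
  moreover have "eff1 l (p - c) = 0"
  proof -
    obtain q where c: "c = 4 * q + 2" using Cons.prems(1) by (metis mult_div_mod_eq)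
    obtain q' where p: "p = 4 * q' \<or> p = 4 * q' + 1" using Cons.prems(3)
      by (metis add.right_neutral insert_iff mult_div_mod_eq singletonD)
    show ?thesis
      using Cons.prems(2) p by (cases l) (auto simp: delta_def hop_def c; presburger)+
  qed
  ultimately show ?case by simp
qed simp

text \<open>Without \<open>Stop\<close> and \<open>Back\<close> all changes happen in the residue
  class of the cursor, because hops are multiples of \<open>4\<close>.\<close>

lemma eff_even_class:
  "c mod 4 = 0 \<Longrightarrow> set ls \<subseteq> forward \<Longrightarrow> p mod 4 \<noteq> 0 \<Longrightarrow> eff c ls p = 0"
proof (induction ls arbitrary: c)
  case (Cons l ls)
  have "l \<noteq> Stop" using Cons.prems by auto
  then have "(c + shift1 l) mod 4 = 0"
    using Cons.prems shift1_mod[of l] by (metis add_0 mod_add_eq mod_0)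
  then have "eff (c + shift1 l) ls p = 0" using Cons by simp
  moreover have "eff1 l (p - c) = 0"
    using Cons.prems by (auto simp: delta_def hop_def; presburger)
  ultimately show ?case by simp
qed simp

text \<open>The invariants force the shape of a word for \<open>target x\<close>: exactly one
  \<open>Stop\<close>, and no \<open>Back\<close> before it. The part before \<open>Stop\<close> is
  then a genuine simulation, whatever follows.\<close>

lemma reach_of_target_in_simulator:
  assumes "target x \<in> simulator"
  shows "(x, 1) \<in> (astep (set rs))\<^sup>*"
proof -
  obtain ls where ls: "set ls \<subseteq> letters" "target x = (eff 0 ls, cur 0 ls)"
    using assms by (auto simp: mem_simulator_iff)
  have eff: "eff 0 ls = (\<lambda>p. - int x * delta 0 (p - 0) + 1 * delta 3 (p - 0))"
    using ls(2) by (simp add: target_def)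
  \<comment> \<open>The only odd cell in the support of \<open>target x\<close> is \<open>3\<close>,
    with value \<open>1\<close>.\<close>
  have "int (count_list ls Stop) = 1"
    unfolding weight_odd_eff[of 0 ls, symmetric, simplified] eff weight_two by simp
  then have cnt: "count_list ls Stop = 1" by simp
  then have "Stop \<in> set ls" by (metis count_notin zero_neq_one)
  then obtain A B where AB: "ls = A @ Stop # B"
    by (meson split_list)
  have nS: "Stop \<notin> set A" "Stop \<notin> set B"
    using cnt by (auto simp: AB count_list_0_iff)
  have mod_cur: "cur c xs mod 4 = c mod 4" if "Stop \<notin> set xs" for c xs
    using that
  proof (induction xs arbitrary: c)
    case (Cons l xs)
    then have "shift1 l mod 4 = 0" by (intro shift1_mod) auto
    then show ?case using Cons by (simp add: mod_add_eq[symmetric, of c])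
  qed simp
  define e where "e = cur 0 A"
  have e4: "e mod 4 = 0" using mod_cur[OF nS(1), of 0] by (simp add: e_def)
  then have e2: "(e + 2) mod 4 = 2" by presburger
  have split: "eff 0 ls p = eff 0 A p + (delta 3 (p - e) - delta 0 (p - e) + eff (e + 2) B p)" for p
    by (simp add: AB eff_append e_def)
  \<comment> \<open>\<open>B\<close> does not touch classes \<open>0\<close> and \<open>1\<close>,
    and \<open>Stop\<close> puts its unit into class \<open>3\<close>. So these two classes show the
    effect of \<open>A\<close> alone, up to the unit that \<open>Stop\<close> takes from cell
    \<open>e\<close>.\<close>
  have A01: "eff 0 A p = - int x * delta 0 p + delta e p" if "p mod 4 \<in> {0, 1}" for p
  proof -
    have "p \<noteq> 3" "p \<noteq> e + 3" using that e4 by (auto; presburger)+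
    then show ?thesis
      using split[of p] eff_odd_class[OF e2 nS(2) that] eff
      by (auto simp: delta_def)
  qed
  \<comment> \<open>By \<open>A01\<close> the run of \<open>A\<close> leaves class \<open>1\<close>
    empty, so the functional that counts \<open>Back\<close> vanishes.\<close>
  have "- 4 * int (count_list A Back) = weight (\<lambda>p. of_bool (p mod 4 = 1) * p) (eff 0 A)"
    by (rule weight_back_eff[symmetric]) (use nS in auto)
  also have "\<dots> = 0"
    unfolding weight_def
  proof (rule sum.neutral, safe)
    fix p assume "eff 0 A p \<noteq> 0"
    show "of_bool (p mod 4 = 1) * p * eff 0 A p = 0"
    proof (cases "p mod 4 = 1")
      case True
      then have "p \<noteq> 0" "p \<noteq> e" using e4 by auto
      with True A01[of p] show ?thesis by (simp add: delta_def)
    qed simp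
  qed
  finally have "Back \<notin> set A" by (simp add: count_list_0_iff)
  then have A: "set A \<subseteq> forward"
    using ls(1) nS by (auto simp: AB letters_def)
  show ?thesis
  proof (rule reach_of_forward[OF A, where n = "\<lambda>_. 0" and x = "int x"])
    show "eff 0 A p = delta (cur 0 A) p - int x * delta 0 p - (\<Sum>i<length rs. 0 * ra i * delta (hop i) p)" for p
    proof (cases "p mod 4 = 0")
      case True
      then show ?thesis using A01[of p] by (simp add: e_def)
    next
      case False
      then have "p \<noteq> 0" "p \<noteq> e" using e4 by auto
      then show ?thesis
        using eff_even_class[OF _ A False, of 0] by (simp add: delta_def e_def)
    qed
  qed auto
qed

theorem target_in_simulator_iff: "target x \<in> simulator \<longleftrightarrow> (x, 1) \<in> (astep (set rs))\<^sup>*"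
  using reach_of_target_in_simulator target_in_simulator_of_reach by blast

end

section \<open>From counter programs to affine rules\<close>

type_synonym store = "nat \<Rightarrow> nat"

datatype op = Nop | Inc nat | Dec nat | Zer nat

datatype cmd = Op op | Seq cmd cmd | Alt cmd cmd | Star cmd

text \<open>Countability numbers the control states, so that each of them can be given its own
  prime.\<close>

instance op :: countable by countable_datatype
instance cmd :: countable by countable_datatype

text \<open>\<open>Dec\<close> and \<open>Zer\<close> have no successor when their test fails; a
  wrong nondeterministic choice in \<open>Alt\<close> or \<open>Star\<close> is discarded by getting
  stuck there.\<close>

fun osem :: "op \<Rightarrow> store rel" where
  "osem Nop = Id"
| "osem (Inc r) = {(s, s(r := Suc (s r))) | s. True}"
| "osem (Dec r) = {(s, s(r := s r - 1)) | s. s r > 0}"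
| "osem (Zer r) = {(s, s) | s. s r = 0}"

fun sem :: "cmd \<Rightarrow> store rel" where
  "sem (Op a) = osem a"
| "sem (Seq c d) = sem c O sem d"
| "sem (Alt c d) = sem c \<union> sem d"
| "sem (Star c) = (sem c)\<^sup>*"

text \<open>The control states of a program are the lists of commands that remain to be executed; only
  finitely many of them (\<open>conts\<close> below) are reachable.\<close>

fun edges :: "cmd list \<Rightarrow> (op \<times> cmd list) set" where
  "edges [] = {}"
| "edges (Op a # k) = {(a, k)}"
| "edges (Seq c d # k) = {(Nop, c # d # k)}"
| "edges (Alt c d # k) = {(Nop, c # k), (Nop, d # k)}"
| "edges (Star c # k) = {(Nop, k), (Nop, c # Star c # k)}"

definition cstep :: "(cmd list \<times> store) rel" where
  "cstep = {((k, s), (k', s')) | k s k' s'. \<exists>a. (a, k') \<in> edges k \<and> (s, s') \<in> osem a}"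

fun ksem :: "cmd list \<Rightarrow> store rel" where
  "ksem [] = Id"
| "ksem (c # k) = sem c O ksem k"

text \<open>\<open>ksem\<close> reads a control state as a sequential composition. Pulling results
  back along one step gives soundness of whole runs by induction.\<close>

lemma cstep_ksem: "((k, s), (k', s')) \<in> cstep \<Longrightarrow> (s', t) \<in> ksem k' \<Longrightarrow> (s, t) \<in> ksem k"
proof (induction k rule: edges.induct)
  case (5 c k)
  then show ?case by (auto simp: cstep_def relcomp_unfold) (meson converse_rtrancl_into_rtrancl)
qed (auto simp: cstep_def)

lemma ksem_of_csteps: "((k, s), ([], t)) \<in> cstep\<^sup>* \<Longrightarrow> (s, t) \<in> ksem k"
  by (induction "(k, s)" arbitrary: k s rule: converse_rtrancl_induct) (auto intro: cstep_ksem)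

lemma csteps_of_sem: "(s, u) \<in> sem c \<Longrightarrow> ((c # k, s), (k, u)) \<in> cstep\<^sup>*"
proof (induction c arbitrary: s u k)
  case (Op a)
  then show ?case by (intro r_into_rtrancl) (auto simp: cstep_def)
next
  case (Seq c d)
  then obtain v where v: "(s, v) \<in> sem c" "(v, u) \<in> sem d" by auto
  have "((Seq c d # k, s), (c # d # k, s)) \<in> cstep" by (auto simp: cstep_def)
  also have "((c # d # k, s), (d # k, v)) \<in> cstep\<^sup>*" using Seq.IH(1) v by blast
  also have "((d # k, v), (k, u)) \<in> cstep\<^sup>*" using Seq.IH(2) v by blast
  finally show ?case .
next
  case (Alt c d)
  have "((Alt c d # k, s), (c # k, s)) \<in> cstep" "((Alt c d # k, s), (d # k, s)) \<in> cstep"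
    by (auto simp: cstep_def)
  then show ?case using Alt by (auto intro: converse_rtrancl_into_rtrancl)
next
  case (Star c)
  have 1: "((Star c # k, s), (k, s)) \<in> cstep" "((Star c # k, s), (c # Star c # k, s)) \<in> cstep" for s
    by (auto simp: cstep_def)
  from Star.prems have "(s, u) \<in> (sem c)\<^sup>*" by simp
  then show ?case
  proof (induction rule: converse_rtrancl_induct)
    case base
    then show ?case using 1 by blast
  next
    case (step s v)
    note 1(2)[of s]
    also have "((c # Star c # k, s), (Star c # k, v)) \<in> cstep\<^sup>*" using Star.IH step by blast
    also have "((Star c # k, v), (k, u)) \<in> cstep\<^sup>*" using step by blast
    finally show ?case .
  qed
qed

lemma csteps_iff_sem: "(([c], s), ([], t)) \<in> cstep\<^sup>* \<longleftrightarrow> (s, t) \<in> sem c"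
  using ksem_of_csteps[of "[c]"] csteps_of_sem by auto

text \<open>The control states met while \<open>c\<close> runs, before \<open>k\<close> takes over.
  A loop body continues with \<open>Star c # k\<close>, which is already listed, so recursion on the
  command suffices and the set is finite.\<close>

fun conts :: "cmd \<Rightarrow> cmd list \<Rightarrow> cmd list set" where
  "conts (Op a) k = {Op a # k}"
| "conts (Seq c d) k = {Seq c d # k} \<union> conts c (d # k) \<union> conts d k"
| "conts (Alt c d) k = {Alt c d # k} \<union> conts c k \<union> conts d k"
| "conts (Star c) k = {Star c # k} \<union> conts c (Star c # k)"

lemma finite_conts: "finite (conts c k)"
  by (induction c k rule: conts.induct) auto

lemma conts_start: "c # k \<in> conts c k"
  by (cases c) auto

lemma conts_closed: "k' \<in> conts c k \<Longrightarrow> (a, k'') \<in> edges k' \<Longrightarrow> k'' \<in> insert k (conts c k)"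
proof (induction c k arbitrary: k' rule: conts.induct)
  case (2 c d k)
  then show ?case using conts_start[of c "d # k"] conts_start[of d k] by fastforce
next
  case (3 c d k)
  then show ?case using conts_start[of c k] conts_start[of d k] by fastforce
next
  case (4 c k)
  then show ?case using conts_start[of c "Star c # k"] by fastforce
qed auto

lemma finite_edges: "finite (edges k)"
  by (cases k rule: edges.cases) auto

section \<open>Stores and control states as products of primes\<close>

definition pr :: "nat \<Rightarrow> nat" where
  "pr = enumerate {p. prime p}"

lemma prime_pr [simp]: "prime (pr i)"
  using enumerate_in_set[OF primes_infinite] by (simp add: pr_def)

lemma pr_eq_iff [simp]: "pr i = pr j \<longleftrightarrow> i = j"
  using strict_mono_enumerate[OF primes_infinite] by (simp add: pr_def strict_mono_eq)

lemma pr_dvd_pr [simp]: "pr i dvd pr j \<longleftrightarrow> i = j"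
  using primes_dvd_imp_eq[OF prime_pr prime_pr, of i j] by auto

lemma pr_pos [simp]: "pr i > 0" "pr i \<noteq> 0" "pr i \<noteq> Suc 0"
  using prime_gt_1_nat[OF prime_pr[of i]] by auto

text \<open>The prime \<open>pr 1\<close> marks the initial state of every program, so that the encoding of inputs does
  not depend on the program.\<close>

definition reg :: "nat \<Rightarrow> nat" where "reg r = pr (2 * r)"
definition st :: "cmd list \<Rightarrow> nat" where "st k = pr (2 * to_nat k + 3)"

lemma st_reg: "prime (st k)" "prime (reg r)" "st k dvd st k' \<longleftrightarrow> k = k'" "\<not> st k dvd reg r"
  "\<not> st k dvd pr (Suc 0)" "\<not> pr (Suc 0) dvd st k" "\<not> pr (Suc 0) dvd reg r" "reg r dvd reg r' \<longleftrightarrow> r = r'"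
  "st k > 0" "reg r > 0"
proof -
  have "2 * r \<noteq> 2 * m + 3" "2 * m + 3 \<noteq> Suc 0" "2 * r \<noteq> Suc 0" for r m :: nat
    by presburger+
  then show "prime (st k)" "prime (reg r)" "st k dvd st k' \<longleftrightarrow> k = k'" "\<not> st k dvd reg r"
    "\<not> st k dvd pr (Suc 0)" "\<not> pr (Suc 0) dvd st k" "\<not> pr (Suc 0) dvd reg r" "reg r dvd reg r' \<longleftrightarrow> r = r'"
    "st k > 0" "reg r > 0"
    unfolding st_def reg_def pr_dvd_pr by (auto dest: sym)
qed

definition enc :: "nat \<Rightarrow> store \<Rightarrow> nat" where
  "enc N s = (\<Prod>r<N. reg r ^ s r)"

lemma prime_dvd_enc: "prime p \<Longrightarrow> p dvd enc N s \<longleftrightarrow> (\<exists>r<N. p dvd reg r \<and> s r > 0)"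
proof -
  assume p: "prime p"
  have "p dvd enc N s \<longleftrightarrow> (\<exists>r\<in>{..<N}. p dvd reg r ^ s r)"
    unfolding enc_def by (rule prime_dvd_prod_iff) (use p in auto)
  also have "\<dots> \<longleftrightarrow> (\<exists>r<N. p dvd reg r \<and> s r > 0)"
    using p prime_dvd_power_iff[OF p] by (metis bot_nat_0.not_eq_extremum lessThan_iff nat_dvd_1_iff_1 not_prime_1 power_0)
  finally show ?thesis .
qed

lemma enc_upd: "r < N \<Longrightarrow> enc N (s(r := Suc (s r))) = reg r * enc N s"
proof -
  assume r: "r < N"
  have "enc N f = reg r ^ f r * (\<Prod>i\<in>{..<N}-{r}. reg i ^ f i)" for f
    unfolding enc_def using r by (intro prod.remove) auto
  from this[of s] this[of "s(r := Suc (s r))"] show ?thesis by simp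
qed

lemma enc_dec: "r < N \<Longrightarrow> s r > 0 \<Longrightarrow> enc N s = reg r * enc N (s(r := s r - 1))"
  using enc_upd[of r N "s(r := s r - 1)"] by simp

lemma enc_eq_1: "enc N s = 1 \<longleftrightarrow> (\<forall>r<N. s r = 0)"
proof
  assume e: "enc N s = 1"
  show "\<forall>r<N. s r = 0"
  proof (rule ccontr)
    assume "\<not> ?thesis"
    then obtain r where "r < N" "s r > 0" by auto
    then have "reg r dvd enc N s" using prime_dvd_enc[OF st_reg(2)[of r], of N s] by auto
    then show False using e prime_gt_1_nat[OF st_reg(2)] by (metis nat_dvd_1_iff_1 less_irrefl)
  qed
qed (simp add: enc_def)

text \<open>A zero test of \<open>r\<close> checks for a nonzero remainder modulo \<open>reg r\<close>.\<close>

fun orules :: "op \<Rightarrow> (nat \<times> nat \<times> nat \<times> nat) set" where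
  "orules Nop = {(1, 0, 1, 0)}"
| "orules (Inc r) = {(1, 0, reg r, 0)}"
| "orules (Dec r) = {(reg r, 0, 1, 0)}"
| "orules (Zer r) = {(reg r, j, reg r, j) | j. 0 < j \<and> j < reg r}"

fun in_range :: "nat \<Rightarrow> op \<Rightarrow> bool" where
  "in_range N Nop \<longleftrightarrow> True"
| "in_range N (Inc r) \<longleftrightarrow> r < N"
| "in_range N (Dec r) \<longleftrightarrow> r < N"
| "in_range N (Zer r) \<longleftrightarrow> r < N"

lemma finite_orules: "finite (orules a)"
  by (cases a) auto

lemma orules_pos: "(m, r, a, b) \<in> orules x \<Longrightarrow> m > 0 \<and> a > 0"
  by (cases x) (auto simp: st_reg)

text \<open>On encoded stores, \<open>reg r\<close> divides the number iff \<open>s r > 0\<close>;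
  so the rules of an operation apply exactly when it does not block.\<close>

lemma astep_orules:
  assumes "in_range N a"
  shows "(enc N s, z) \<in> astep (orules a) \<longleftrightarrow> (\<exists>s'. (s, s') \<in> osem a \<and> z = enc N s')"
proof (cases a)
  case Nop
  then show ?thesis by (auto simp: astep_def)
next
  case (Inc r)
  then show ?thesis using assms enc_upd by (auto simp: astep_def)
next
  case (Dec r)
  then have r: "r < N" using assms by simp
  have "enc N s = reg r * z \<longleftrightarrow> s r > 0 \<and> z = enc N (s(r := s r - 1))"
  proof
    assume e: "enc N s = reg r * z"
    then have "s r > 0" using prime_dvd_enc[OF st_reg(2)[of r], of N s] by (auto simp: st_reg)
    then show "s r > 0 \<and> z = enc N (s(r := s r - 1))"
      using e enc_dec[OF r] st_reg(10)[of r] by simp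
  qed (use enc_dec[OF r] in auto)
  then show ?thesis by (auto simp: astep_def Dec)
next
  case (Zer r)
  then have r: "r < N" using assms by simp
  have "(\<exists>j y. 0 < j \<and> j < reg r \<and> enc N s = reg r * y + j) \<longleftrightarrow> \<not> reg r dvd enc N s"
  proof
    assume "\<exists>j y. 0 < j \<and> j < reg r \<and> enc N s = reg r * y + j"
    then show "\<not> reg r dvd enc N s"
      using nat_dvd_not_less by (auto simp: dvd_add_right_iff)
  next
    assume "\<not> reg r dvd enc N s"
    then have "0 < enc N s mod reg r" by (simp add: mod_greater_zero_iff_not_dvd)
    moreover have "enc N s mod reg r < reg r" by (simp add: st_reg)
    ultimately show "\<exists>j y. 0 < j \<and> j < reg r \<and> enc N s = reg r * y + j"
      by (metis mult_div_mod_eq)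
  qed
  also have "\<dots> \<longleftrightarrow> s r = 0" using prime_dvd_enc[OF st_reg(2)[of r], of N s] r by (auto simp: st_reg)
  finally show ?thesis by (auto simp: astep_def Zer)
qed

definition inp :: "nat \<Rightarrow> nat" where "inp n = pr 1 * pr 0 ^ n"

definition init :: "nat \<Rightarrow> store" where "init n = (\<lambda>_. 0)(0 := n)"

text \<open>Attaches a control transition to rules that act on the store: the prime \<open>P\<close>
  is consumed and \<open>Q\<close> is produced.\<close>

definition lift :: "nat \<Rightarrow> nat \<Rightarrow> (nat \<times> nat \<times> nat \<times> nat) set \<Rightarrow> (nat \<times> nat \<times> nat \<times> nat) set" where
  "lift P Q R = (\<lambda>(m, r, a, b). (P * m, P * r, Q * a, Q * b)) ` R"

lemma astep_lift: "(x, x') \<in> astep (lift P Q R) \<longleftrightarrow> (\<exists>z z'. x = P * z \<and> x' = Q * z' \<and> (z, z') \<in> astep R)"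
proof
  assume "(x, x') \<in> astep (lift P Q R)"
  then obtain m r a b y where "(m, r, a, b) \<in> R" "x = P * (m * y + r)" "x' = Q * (a * y + b)"
    unfolding astep_def lift_def distrib_left mult.assoc[symmetric] by force
  then show "\<exists>z z'. x = P * z \<and> x' = Q * z' \<and> (z, z') \<in> astep R"
    unfolding astep_def by blast
next
  assume "\<exists>z z'. x = P * z \<and> x' = Q * z' \<and> (z, z') \<in> astep R"
  then obtain m r a b y where *: "(m, r, a, b) \<in> R" "x = P * (m * y + r)" "x' = Q * (a * y + b)"
    unfolding astep_def by blast
  have "(P * m, P * r, Q * a, Q * b) \<in> lift P Q R"
    unfolding lift_def using *(1) by (rule rev_image_eqI) simp
  moreover have "x = P * m * y + P * r" "x' = Q * a * y + Q * b" using * by (simp_all add: algebra_simps)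
  ultimately show "(x, x') \<in> astep (lift P Q R)" unfolding astep_def by blast
qed

lemma astep_insert: "astep (insert (m, r, a, b) R) = {(m * y + r, a * y + b) | y. True} \<union> astep R"
  unfolding astep_def by blast

lemma astep_Un: "astep (R \<union> S) = astep R \<union> astep S"
  unfolding astep_def by blast

lemma astep_UN: "astep (\<Union>i\<in>I. R i) = (\<Union>i\<in>I. astep (R i))"
  unfolding astep_def by blast

text \<open>The first rule exchanges the start mark for the control state of \<open>c\<close>. The
  second drops the control prime of the finished program, so that \<open>1\<close> remains only if
  all encoded registers are zero.\<close>

definition rules :: "cmd \<Rightarrow> (nat \<times> nat \<times> nat \<times> nat) set" where
  "rules c = {(pr 1, 0, st [c], 0), (st [], 0, 1, 0)} \<union>
    (\<Union>k\<in>conts c []. \<Union>(a, k')\<in>edges k. lift (st k) (st k') (orules a))"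

lemma astep_rules: "(x, x') \<in> astep (rules c) \<longleftrightarrow>
    (\<exists>y. x = pr 1 * y \<and> x' = st [c] * y) \<or> x = st [] * x' \<or>
    (\<exists>k\<in>conts c []. \<exists>a k' z z'. (a, k') \<in> edges k \<and> x = st k * z \<and> x' = st k' * z' \<and> (z, z') \<in> astep (orules a))"
proof -
  have "astep {(pr 1, 0, st [c], 0), (st [], 0, 1, 0)} = {(pr 1 * y, st [c] * y) |y. True} \<union> {(st [] * y, y) | y. True}"
    by (auto simp: astep_insert) (auto simp: astep_def)
  moreover have "(x, x') \<in> astep (\<Union>k\<in>conts c []. \<Union>(a, k')\<in>edges k. lift (st k) (st k') (orules a)) \<longleftrightarrow>
    (\<exists>k\<in>conts c []. \<exists>a k' z z'. (a, k') \<in> edges k \<and> x = st k * z \<and> x' = st k' * z' \<and> (z, z') \<in> astep (orules a))"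
    by (simp add: astep_UN case_prod_unfold astep_lift Bex_def split_paired_Ex)
  ultimately show ?thesis
    unfolding rules_def astep_Un by auto
qed

lemma finite_rules: "finite (rules c)"
  unfolding rules_def lift_def using finite_conts finite_edges finite_orules by auto

lemma rules_pos: "(m, r, a, b) \<in> rules c \<Longrightarrow> m > 0 \<and> a > 0"
  unfolding rules_def lift_def by (auto simp: st_reg dest: orules_pos)

lemma ex_range: "\<exists>N>0. \<forall>k\<in>conts c []. \<forall>a k'. (a, k') \<in> edges k \<longrightarrow> in_range N a"
proof -
  have ex: "\<exists>N. in_range N a" for a by (cases a) auto
  have mono: "in_range N a \<Longrightarrow> N \<le> N' \<Longrightarrow> in_range N' a" for N N' a by (cases a) auto
  have "finite (\<Union>k\<in>conts c []. fst ` edges k)" using finite_conts finite_edges by auto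
  then have "\<exists>N>0. \<forall>a\<in>(\<Union>k\<in>conts c []. fst ` edges k). in_range N a"
  proof (induction rule: finite_induct)
    case (insert a A)
    then obtain N where N: "N > 0" "\<forall>a\<in>A. in_range N a" by blast
    obtain N' where N': "in_range N' a" using ex by blast
    show ?case
      using N N' mono[of N _ "max N N'"] mono[of N' _ "max N N'"] by (intro exI[of _ "max N N'"]) auto
  qed auto
  then show ?thesis by force
qed

lemma not_st_dvd_enc: "\<not> st k dvd enc N s" "\<not> pr (Suc 0) dvd enc N s"
  by (auto simp: prime_dvd_enc st_reg)

text \<open>No control prime divides an encoded store, so the control state of a configuration can
  be read off uniquely.\<close>

lemma conf_eq: "st k * enc N s = st k' * z \<longleftrightarrow> k = k' \<and> z = enc N s"
proof
  assume e: "st k * enc N s = st k' * z"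
  then have "st k' dvd st k * enc N s" by simp
  then have "k' = k" using not_st_dvd_enc by (simp add: prime_dvd_mult_iff st_reg)
  then show "k = k' \<and> z = enc N s" using e st_reg(9)[of k] by simp
qed simp

theorem rules_correct:
  "(inp n, 1) \<in> (astep (rules c))\<^sup>* \<longleftrightarrow> (init n, \<lambda>_. 0) \<in> sem c"
proof -
  obtain N where N: "N > 0" "\<And>k a k'. k \<in> conts c [] \<Longrightarrow> (a, k') \<in> edges k \<Longrightarrow> in_range N a"
    using ex_range[of c] by auto
  let ?e = "enc N" and ?A = "astep (rules c)"
  have init: "?e (init n) = pr 0 ^ n"
  proof -
    have "?e (init n) = (\<Prod>r<N. if r = 0 then reg 0 ^ n else 1)"
      unfolding enc_def by (rule prod.cong) (auto simp: init_def)
    then show ?thesis using N(1) by (simp add: reg_def)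
  qed
  \<comment> \<open>Every rule needs the start mark or a control prime on its left side. Once the
    control prime is dropped, the run is over and the number must already be
    \<open>1\<close>.\<close>
  have stuck: "(?e s, x) \<notin> ?A" for s x
  proof
    assume "(?e s, x) \<in> ?A"
    then have "pr 1 dvd ?e s \<or> (\<exists>k. st k dvd ?e s)"
      unfolding astep_rules by (metis dvd_triv_left)
    then show False using not_st_dvd_enc by auto
  qed
  \<comment> \<open>\<open>enc N\<close> does not see registers from \<open>N\<close> on. Keeping
    them zero lets \<open>enc N s = 1\<close> identify the zero store.\<close>
  have supp: "\<forall>r\<ge>N. s' r = 0" if "in_range N a" "(s, s') \<in> osem a" "\<forall>r\<ge>N. s r = 0" for a s s'
    using that by (cases a) auto
  have conf_step: "(st k * ?e s, x) \<in> ?A \<longleftrightarrow>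
      (k = [] \<and> x = ?e s) \<or> (\<exists>k' s'. ((k, s), (k', s')) \<in> cstep \<and> x = st k' * ?e s')"
    if "k \<in> insert [] (conts c [])" for k s x
  proof -
    have "\<not> pr 1 dvd st k * ?e s" using not_st_dvd_enc by (simp add: prime_dvd_mult_iff st_reg)
    then have 1: "\<not> (\<exists>y. st k * ?e s = pr 1 * y \<and> x = st [c] * y)" by (metis dvd_triv_left)
    have "(\<exists>k0\<in>conts c []. \<exists>a k' z z'. (a, k') \<in> edges k0 \<and> st k * ?e s = st k0 * z \<and> x = st k' * z' \<and> (z, z') \<in> astep (orules a))
      \<longleftrightarrow> (\<exists>k' s'. ((k, s), (k', s')) \<in> cstep \<and> x = st k' * ?e s')"
      (is "?L \<longleftrightarrow> ?R")
    proof
      assume ?L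
      then obtain a k' z' where *: "k \<in> conts c []" "(a, k') \<in> edges k" "x = st k' * z'" "(?e s, z') \<in> astep (orules a)"
        by (auto simp: conf_eq)
      then show ?R using astep_orules[OF N(2)[OF *(1,2)]] by (auto simp: cstep_def)
    next
      assume ?R
      then obtain a k' s' where *: "(a, k') \<in> edges k" "(s, s') \<in> osem a" "x = st k' * ?e s'"
        by (auto simp: cstep_def)
      then have "k \<noteq> []" by auto
      then have k: "k \<in> conts c []" using that by simp
      have "(?e s, ?e s') \<in> astep (orules a)" using astep_orules[OF N(2)[OF k *(1)]] * by auto
      then show ?L using k * by blast
    qed
    then show ?thesis unfolding astep_rules using 1 by (auto simp: conf_eq)
  qed
  have closed: "k' \<in> insert [] (conts c []) \<and> (\<forall>r\<ge>N. s' r = 0)"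
    if step: "((k, s), (k', s')) \<in> cstep" and k_in: "k \<in> insert [] (conts c [])" and s: "\<forall>r\<ge>N. s r = 0" for k s k' s'
  proof -
    obtain a where a: "(a, k') \<in> edges k" "(s, s') \<in> osem a" using step by (auto simp: cstep_def)
    then have "k \<noteq> []" by auto
    then have k: "k \<in> conts c []" using k_in by simp
    show ?thesis using conts_closed[OF k a(1)] supp[OF N(2)[OF k a(1)] a(2) s] by blast
  qed
  have to_1: "(st k * ?e s, 1) \<in> ?A\<^sup>*"
    if "((k, s), ([], \<lambda>_. 0)) \<in> cstep\<^sup>*" "k \<in> insert [] (conts c [])" "\<forall>r\<ge>N. s r = 0" for k s
    using that
  proof (induction "(k, s)" arbitrary: k s rule: converse_rtrancl_induct)
    case base
    have "(st [] * ?e (\<lambda>_. 0), ?e (\<lambda>_. 0)) \<in> ?A" using conf_step[of "[]"] by simp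
    moreover have "?e (\<lambda>_. 0) = 1" unfolding enc_eq_1 by simp
    ultimately show ?case by auto
  next
    case (step y k s)
    obtain k' s' where y: "y = (k', s')" by force
    then have "((k, s), (k', s')) \<in> cstep" using step(1) by simp
    moreover from closed[OF this] have "(st k' * ?e s', 1) \<in> ?A\<^sup>*" using step y by blast
    ultimately show ?case using conf_step[OF step(4), of s] by (blast intro: converse_rtrancl_into_rtrancl)
  qed
  have from_1: "((k, s), ([], \<lambda>_. 0)) \<in> cstep\<^sup>*"
    if "(x, 1) \<in> ?A\<^sup>*" "x = st k * ?e s" "k \<in> insert [] (conts c [])" "\<forall>r\<ge>N. s r = 0" for x k s
    using that
  proof (induction x arbitrary: k s rule: converse_rtrancl_induct)
    case base
    then show ?case using prime_gt_1_nat[OF st_reg(1)[of k]] by (metis dvd_triv_left nat_dvd_1_iff_1 less_irrefl)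
  next
    case (step x x')
    then consider "k = []" "x' = ?e s" | k' s' where "((k, s), (k', s')) \<in> cstep" "x' = st k' * ?e s'"
      using conf_step by blast
    then show ?case
    proof cases
      case 1
      then have "?e s = 1" using step(2) stuck by (metis converse_rtranclE)
      then have "s = (\<lambda>_. 0)" unfolding enc_eq_1 using step.prems(3) by (metis not_less)
      then show ?thesis using 1 by simp
    next
      case 2
      have "((k', s'), ([], \<lambda>_. 0)) \<in> cstep\<^sup>*"
        using step.IH[OF 2(2)] closed[OF 2(1) step.prems(2,3)] by blast
      then show ?thesis using 2(1) by (rule converse_rtrancl_into_rtrancl[rotated])
    qed
  qed
  have start: "(inp n, x) \<in> ?A \<longleftrightarrow> x = st [c] * ?e (init n)" for x
  proof -
    have no: "\<not> st k dvd inp n" for k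
      using not_st_dvd_enc(1)[of k N "init n"] by (simp add: inp_def prime_dvd_mult_iff st_reg init)
    have "\<not> inp n = st k * z" for k z using no by (metis dvd_triv_left)
    then show ?thesis unfolding astep_rules init by (auto simp: inp_def)
  qed
  have c: "[c] \<in> insert [] (conts c [])" using conts_start[of c "[]"] by simp
  have sup0: "\<forall>r\<ge>N. init n r = 0" using N(1) by (simp add: init_def)
  \<comment> \<open>So a run to \<open>1\<close> has at least one step, and its first step is
    determined by \<open>start\<close>.\<close>
  have "inp n \<noteq> 1" using prime_gt_1_nat[OF prime_pr[of 1]] by (simp add: inp_def)
  then have "(inp n, 1) \<in> ?A\<^sup>* \<longleftrightarrow> (st [c] * ?e (init n), 1) \<in> ?A\<^sup>*"
    by (metis converse_rtranclE converse_rtrancl_into_rtrancl start)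
  also have "\<dots> \<longleftrightarrow> (([c], init n), ([], \<lambda>_. 0)) \<in> cstep\<^sup>*"
    using to_1[OF _ c sup0] from_1[OF _ refl c sup0] by blast
  finally show ?thesis by (simp add: csteps_iff_sem)
qed

section \<open>Programs for partial recursive functions\<close>

inductive_simps eval_simps:
  "eval Zero xs y" "eval Succ xs y" "eval (Proj i) xs y" "eval (Comp f gs) xs y"
  "eval (PrimRec f g) [] y" "eval (PrimRec f g) (0 # xs) y" "eval (PrimRec f g) (Suc n # xs) y"
  "eval (Mu f) xs n"

lemma sem_iffs:
  "(s, t) \<in> sem (Seq c d) \<longleftrightarrow> (\<exists>u. (s, u) \<in> sem c \<and> (u, t) \<in> sem d)"
  "(s, t) \<in> sem (Op (Inc r)) \<longleftrightarrow> t = s(r := Suc (s r))"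
  "(s, t) \<in> sem (Op (Dec r)) \<longleftrightarrow> s r > 0 \<and> t = s(r := s r - 1)"
  "(s, t) \<in> sem (Op (Zer r)) \<longleftrightarrow> s r = 0 \<and> t = s"
  by auto

text \<open>Joins the exact description of a program, as in \<open>computes\<close>, with that of
  its continuation.\<close>

lemma ex_chain: "(\<exists>u. (\<exists>z. P z \<and> u = f z) \<and> Q u) \<longleftrightarrow> (\<exists>z. P z \<and> Q (f z))"
  by blast

section \<open>Clearing, moving and copying registers\<close>

definition clear :: "nat \<Rightarrow> cmd" where
  "clear r = Seq (Star (Op (Dec r))) (Op (Zer r))"

fun clears :: "nat list \<Rightarrow> cmd" where
  "clears [] = Op Nop"
| "clears (r # rs) = Seq (clear r) (clears rs)"

definition drain :: "nat \<Rightarrow> cmd \<Rightarrow> cmd" where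
  "drain a c = Seq (Star (Seq (Op (Dec a)) c)) (Op (Zer a))"

definition move :: "nat \<Rightarrow> nat \<Rightarrow> cmd" where
  "move a b = drain a (Op (Inc b))"

text \<open>Draining destroys the source, so \<open>c\<close> collects a second copy from which it
  is restored.\<close>

definition copy :: "nat \<Rightarrow> nat \<Rightarrow> nat \<Rightarrow> cmd" where
  "copy a b c = Seq (drain a (Seq (Op (Inc b)) (Op (Inc c)))) (move c a)"

lemma relpow_Suc_iff: "(s, t) \<in> R ^^ Suc n \<longleftrightarrow> (\<exists>u. (s, u) \<in> R \<and> (u, t) \<in> R ^^ n)"
  by (meson relpow_Suc_D2 relpow_Suc_I2)

text \<open>Each round lowers \<open>a\<close> by exactly one and the loop can be left only at zero,
  so the number of rounds is forced. The invariant \<open>I\<close> limits the claim about the body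
  to the stores that occur.\<close>

lemma sem_drain:
  assumes step: "\<And>s t. I s \<Longrightarrow> (s, t) \<in> sem (Seq (Op (Dec a)) c) \<Longrightarrow> I t \<and> s a = Suc (t a)"
    and s: "I s"
  shows "(s, t) \<in> sem (drain a c) \<longleftrightarrow> (s, t) \<in> sem (Seq (Op (Dec a)) c) ^^ s a"
proof -
  let ?Q = "sem (Seq (Op (Dec a)) c)"
  have pow: "s a = t a + n" if "I s" "(s, t) \<in> ?Q ^^ n" for n s t
    using that
  proof (induction n arbitrary: s)
    case (Suc n)
    then obtain u where u: "(s, u) \<in> ?Q" "(u, t) \<in> ?Q ^^ n" unfolding relpow_Suc_iff by blast
    then show ?case using Suc.IH[of u] step[OF Suc.prems(1) u(1)] by simp
  qed simp
  have "(s, t) \<in> sem (drain a c) \<longleftrightarrow> (\<exists>n. (s, t) \<in> ?Q ^^ n) \<and> t a = 0"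
    by (auto simp: drain_def rtrancl_is_UN_relpow relcomp_unfold simp del: sem.simps(2) simp: sem.simps(2)[of "Star _"])
  also have "\<dots> \<longleftrightarrow> (s, t) \<in> ?Q ^^ s a"
    using pow[OF s] by (metis add.right_neutral add_0 add_right_cancel)
  finally show ?thesis .
qed

lemma sem_clear [simp]: "(s, t) \<in> sem (clear r) \<longleftrightarrow> t = s(r := 0)"
proof
  have others: "t j = s j" if "(s, t) \<in> (osem (Dec r))\<^sup>*" "j \<noteq> r" for t j
    using that by (induction rule: rtrancl_induct) auto
  assume "(s, t) \<in> sem (clear r)"
  then have "(s, t) \<in> (osem (Dec r))\<^sup>*" "t r = 0" by (auto simp: clear_def)
  with others show "t = s(r := 0)" by auto
next
  have "(s, s(r := 0)) \<in> (osem (Dec r))\<^sup>*" if "s r = n" for n s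
    using that
  proof (induction n arbitrary: s)
    case 0
    then have "s(r := 0) = s" by auto
    then show ?case by simp
  next
    case (Suc n)
    have "(s, s(r := n)) \<in> osem (Dec r)" using Suc.prems by auto
    moreover have "(s(r := n), s(r := n, r := 0)) \<in> (osem (Dec r))\<^sup>*" by (rule Suc.IH) simp
    then have "(s(r := n), s(r := 0)) \<in> (osem (Dec r))\<^sup>*" unfolding fun_upd_upd .
    ultimately show ?case by (rule converse_rtrancl_into_rtrancl)
  qed
  moreover assume "t = s(r := 0)"
  ultimately show "(s, t) \<in> sem (clear r)"
    unfolding clear_def sem.simps by (intro relcompI[of _ "s(r := 0)"]) (simp_all del: osem.simps(3))
qed

lemma sem_clears [simp]: "(s, t) \<in> sem (clears rs) \<longleftrightarrow> t = (\<lambda>j. if j \<in> set rs then 0 else s j)"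
proof (induction rs arbitrary: s)
  case (Cons r rs)
  have "(\<lambda>j. if j \<in> set rs then 0 else (s(r := 0)) j) = (\<lambda>j. if j \<in> set (r # rs) then 0 else s j)"
    by auto
  then show ?case by (simp add: sem_iffs Cons del: sem.simps)
qed auto

lemma sem_move [simp]:
  assumes "a \<noteq> b"
  shows "(s, t) \<in> sem (move a b) \<longleftrightarrow> t = s(a := 0, b := s b + s a)"
proof -
  define Q where "Q = sem (Seq (Op (Dec a)) (Op (Inc b)))"
  have Q: "(s, t) \<in> Q \<longleftrightarrow> s a > 0 \<and> t = s(a := s a - 1, b := Suc (s b))" for s t
    using assms by (auto simp: relcomp_unfold Q_def)
  have "(s, t) \<in> Q ^^ n \<longleftrightarrow> t = s(a := 0, b := s b + s a)" if "n = s a" for n s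
    using that
  proof (induction n arbitrary: s)
    case 0
    then have "s(a := 0, b := s b + s a) = s" by (auto simp: fun_eq_iff)
    then show ?case by (metis pair_in_Id_conv relpow.simps(1))
  next
    case (Suc n)
    let ?v = "s(a := s a - 1, b := Suc (s b))"
    have "(s, t) \<in> Q ^^ Suc n \<longleftrightarrow> (?v, t) \<in> Q ^^ n"
      unfolding relpow_Suc_iff Q using Suc.prems by simp
    also have "\<dots> \<longleftrightarrow> t = ?v(a := 0, b := ?v b + ?v a)"
      using Suc.prems assms by (intro Suc.IH) simp
    also have "?v(a := 0, b := ?v b + ?v a) = s(a := 0, b := s b + s a)"
      using Suc.prems[symmetric] assms by (auto simp: fun_eq_iff)
    finally show ?case .
  qed
  moreover have "(s, t) \<in> sem (drain a (Op (Inc b))) \<longleftrightarrow> (s, t) \<in> Q ^^ s a"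
    unfolding Q_def
    by (rule sem_drain[where I = "\<lambda>_. True"], unfold Q_def[symmetric] Q) (use assms in auto)
  ultimately show ?thesis unfolding move_def by simp
qed

lemma sem_copy [simp]:
  assumes "a \<noteq> b" "a \<noteq> c" "b \<noteq> c" "s c = 0"
  shows "(s, t) \<in> sem (copy a b c) \<longleftrightarrow> t = s(b := s b + s a)"
proof -
  let ?c = "Seq (Op (Inc b)) (Op (Inc c))"
  define Q where "Q = sem (Seq (Op (Dec a)) ?c)"
  have Q: "(s, t) \<in> Q \<longleftrightarrow> s a > 0 \<and> t = s(a := s a - 1, b := Suc (s b), c := Suc (s c))" for s t
    using assms(1-3) by (auto simp: relcomp_unfold Q_def)
  have pow: "(s, t) \<in> Q ^^ n \<longleftrightarrow> t = s(a := 0, b := s b + s a, c := s c + s a)" if "n = s a" for n s t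
    using that
  proof (induction n arbitrary: s)
    case 0
    then have "s(a := 0, b := s b + s a, c := s c + s a) = s" by (auto simp: fun_eq_iff)
    then show ?case by (metis pair_in_Id_conv relpow.simps(1))
  next
    case (Suc n)
    let ?v = "s(a := s a - 1, b := Suc (s b), c := Suc (s c))"
    have "(s, t) \<in> Q ^^ Suc n \<longleftrightarrow> (?v, t) \<in> Q ^^ n"
      unfolding relpow_Suc_iff Q using Suc.prems by simp
    also have "\<dots> \<longleftrightarrow> t = ?v(a := 0, b := ?v b + ?v a, c := ?v c + ?v a)"
      using Suc.prems assms(1-3) by (intro Suc.IH) simp
    also have "?v(a := 0, b := ?v b + ?v a, c := ?v c + ?v a) = s(a := 0, b := s b + s a, c := s c + s a)"
      using Suc.prems[symmetric] assms(1-3) by (auto simp: fun_eq_iff)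
    finally show ?case .
  qed
  have "(s, t) \<in> sem (drain a ?c) \<longleftrightarrow> (s, t) \<in> Q ^^ s a" for s t
    unfolding Q_def
    by (rule sem_drain[where I = "\<lambda>_. True"], unfold Q_def[symmetric] Q) (use assms(1-3) in auto)
  with pow have "(s, t) \<in> sem (copy a b c) \<longleftrightarrow>
      (s(a := 0, b := s b + s a, c := s c + s a), t) \<in> sem (move c a)"
    unfolding copy_def sem.simps(2) relcomp_unfold by simp
  also have "\<dots> \<longleftrightarrow> t = s(b := s b + s a)"
  proof -
    let ?u = "s(a := 0, b := s b + s a, c := s c + s a)"
    have "?u(c := 0, a := ?u a + ?u c) = s(b := s b + s a)"
      using assms by (auto simp: fun_eq_iff)
    then show ?thesis using sem_move[of c a ?u t] assms(2) by simp
  qed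
  finally show ?thesis .
qed

text \<open>The arguments are read from the registers \<open>rs\<close>, and all registers from \<open>b\<close> on are free for
  scratch use.\<close>

definition computes :: "cmd \<Rightarrow> recf \<Rightarrow> nat list \<Rightarrow> nat \<Rightarrow> nat \<Rightarrow> bool" where
  "computes c f rs out b \<longleftrightarrow> (\<forall>s. (\<forall>j\<ge>b. s j = 0) \<longrightarrow> s out = 0 \<longrightarrow>
    (\<forall>t. (s, t) \<in> sem c \<longleftrightarrow> (\<exists>y. eval f (map s rs) y \<and> t = s(out := y))))"

lemma computesD:
  "computes c f rs out b \<Longrightarrow> (\<And>j. j \<ge> b \<Longrightarrow> s j = 0) \<Longrightarrow> s out = 0 \<Longrightarrow>
    (s, t) \<in> sem c \<longleftrightarrow> (\<exists>y. eval f (map s rs) y \<and> t = s(out := y))"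
  unfolding computes_def by blast

text \<open>Quantifying over all register placements makes the induction over codes work: a
  subprogram is given its own output register and a higher scratch bound.\<close>

definition computable :: "recf \<Rightarrow> bool" where
  "computable f \<longleftrightarrow>
    (\<forall>rs out b. set rs \<subseteq> {..<b} \<longrightarrow> out < b \<longrightarrow> out \<notin> set rs \<longrightarrow> (\<exists>c. computes c f rs out b))"

lemma computableD:
  "computable f \<Longrightarrow> set rs \<subseteq> {..<b} \<Longrightarrow> out < b \<Longrightarrow> out \<notin> set rs \<Longrightarrow> \<exists>c. computes c f rs out b"
  unfolding computable_def by blast

section \<open>Compilation of the recursive function schemes\<close>

lemma computable_Zero: "computable Zero"
  unfolding computable_def computes_def
  by (auto simp: eval_simps fun_upd_idem intro!: exI[of _ "Op Nop"])

text \<open>A program without runs, for codes applied to a wrong number of arguments.\<close>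

lemma sem_Fail: "sem (Seq (Op (Inc 0)) (Op (Zer 0))) = {}"
  by auto

lemma computable_Succ: "computable Succ"
  unfolding computable_def
proof (intro allI impI)
  fix rs :: "nat list" and out b :: nat
  assume rs: "set rs \<subseteq> {..<b}" and out: "out < b" "out \<notin> set rs"
  show "\<exists>c. computes c Succ rs out b"
  proof (cases "\<exists>r. rs = [r]")
    case True
    then obtain r where r: "rs = [r]" by blast
    have "computes (Seq (copy r out b) (Op (Inc out))) Succ rs out b"
      unfolding computes_def using rs out by (auto simp: eval_simps relcomp_unfold r)
    then show ?thesis ..
  next
    case False
    then have "\<not> eval Succ (map s rs) y" for s y by (auto simp: eval_simps)
    then show ?thesis unfolding computes_def using sem_Fail by (metis empty_iff)
  qed
qed

lemma computable_Proj: "computable (Proj i)"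
  unfolding computable_def
proof (intro allI impI)
  fix rs :: "nat list" and out b :: nat
  assume rs: "set rs \<subseteq> {..<b}" and out: "out < b" "out \<notin> set rs"
  show "\<exists>c. computes c (Proj i) rs out b"
  proof (cases "i < length rs")
    case True
    then have "rs ! i \<in> set rs" by simp
    then have "rs ! i < b" "rs ! i \<noteq> out" using rs out by auto
    then have "computes (copy (rs ! i) out b) (Proj i) rs out b"
      unfolding computes_def using out True by (auto simp: eval_simps)
    then show ?thesis ..
  next
    case False
    then have "\<not> eval (Proj i) (map s rs) y" for s y by (auto simp: eval_simps)
    then show ?thesis unfolding computes_def using sem_Fail by (metis empty_iff)
  qed
qed

text \<open>The results stay in consecutive registers from \<open>b\<close> on, so the scratch space
  of each further program starts one register later.\<close>

definition computes_list :: "cmd \<Rightarrow> recf list \<Rightarrow> nat list \<Rightarrow> nat \<Rightarrow> bool" where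
  "computes_list c gs rs b \<longleftrightarrow> (\<forall>s. (\<forall>j\<ge>b. s j = 0) \<longrightarrow> (\<forall>t. (s, t) \<in> sem c \<longleftrightarrow>
    (\<exists>ys. list_all2 (\<lambda>g y. eval g (map s rs) y) gs ys \<and>
      t = (\<lambda>j. if b \<le> j \<and> j < b + length ys then ys ! (j - b) else s j))))"

lemma computes_listD:
  "computes_list c gs rs b \<Longrightarrow> \<forall>j\<ge>b. s j = 0 \<Longrightarrow> (s, t) \<in> sem c \<longleftrightarrow>
    (\<exists>ys. list_all2 (\<lambda>g y. eval g (map s rs) y) gs ys \<and>
      t = (\<lambda>j. if b \<le> j \<and> j < b + length ys then ys ! (j - b) else s j))"
  unfolding computes_list_def by blast

lemma ex_computes_list:
  assumes "\<And>g. g \<in> set gs \<Longrightarrow> computable g" "set rs \<subseteq> {..<b}"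
  shows "\<exists>c. computes_list c gs rs b"
  using assms
proof (induction gs arbitrary: b)
  case Nil
  show ?case unfolding computes_list_def by (intro exI[of _ "Op Nop"]) auto
next
  case (Cons g gs)
  have rs: "set rs \<subseteq> {..<Suc b}" "b \<notin> set rs" using Cons.prems(2) by auto
  obtain c1 where c1: "computes c1 g rs b (Suc b)"
    using computableD[OF _ rs(1) _ rs(2), of g] Cons.prems(1) by auto
  obtain c2 where "computes_list c2 gs rs (Suc b)"
    using Cons.IH[OF _ rs(1)] Cons.prems(1) by auto
  note c2 = computes_listD[OF this]
  have "computes_list (Seq c1 c2) (g # gs) rs b"
    unfolding computes_list_def
  proof (intro allI impI)
    fix s t :: store assume s: "\<forall>j\<ge>b. s j = 0"
    have map: "map (s(b := y)) rs = map s rs" for y using rs(2) by auto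
    have upd: "(\<lambda>j. if Suc b \<le> j \<and> j < Suc b + length ys then ys ! (j - Suc b) else (s(b := y)) j) =
      (\<lambda>j. if b \<le> j \<and> j < b + length (y # ys) then (y # ys) ! (j - b) else s j)" for y ys
    proof
      fix j
      consider "j < b" | "j = b" | k where "j = Suc (b + k)"
        by (metis less_imp_Suc_add linorder_neqE_nat)
      then show "(if Suc b \<le> j \<and> j < Suc b + length ys then ys ! (j - Suc b) else (s(b := y)) j) =
          (if b \<le> j \<and> j < b + length (y # ys) then (y # ys) ! (j - b) else s j)"
        by cases auto
    qed
    have "(s, t) \<in> sem (Seq c1 c2) \<longleftrightarrow>
        (\<exists>y. eval g (map s rs) y \<and> (s(b := y), t) \<in> sem c2)"
      using computesD[OF c1, of s] s by (auto simp: relcomp_unfold)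
    also have "\<dots> \<longleftrightarrow> (\<exists>y. eval g (map s rs) y \<and> (\<exists>ys. list_all2 (\<lambda>g y. eval g (map s rs) y) gs ys \<and>
        t = (\<lambda>j. if b \<le> j \<and> j < b + length (y # ys) then (y # ys) ! (j - b) else s j)))"
      using c2[of "s(b := _)"] s unfolding map upd by simp
    also have "\<dots> \<longleftrightarrow> (\<exists>ys. list_all2 (\<lambda>g y. eval g (map s rs) y) (g # gs) ys \<and>
      t = (\<lambda>j. if b \<le> j \<and> j < b + length ys then ys ! (j - b) else s j))"
      unfolding list_all2_Cons1 by blast
    finally show "(s, t) \<in> sem (Seq c1 c2) \<longleftrightarrow> \<dots>" .
  qed
  then show ?case ..
qed

lemma computable_Comp:
  assumes f: "computable f" and gs: "\<And>g. g \<in> set gs \<Longrightarrow> computable g"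
  shows "computable (Comp f gs)"
  unfolding computable_def
proof (intro allI impI)
  fix rs :: "nat list" and out b :: nat
  assume rs: "set rs \<subseteq> {..<b}" and out: "out < b" "out \<notin> set rs"
  let ?k = "length gs"
  obtain c1 where "computes_list c1 gs rs b"
    using ex_computes_list[OF gs rs] by blast
  note c1 = computes_listD[OF this]
  obtain c2 where c2: "computes c2 f [b..<b + ?k] out (b + ?k)"
    using computableD[OF f, of "[b..<b + ?k]" "b + ?k" out] out by fastforce
  \<comment> \<open>The intermediate results are erased at the end because only \<open>out\<close>
    may differ from the initial store.\<close>
  have "computes (Seq c1 (Seq c2 (clears [b..<b + ?k]))) (Comp f gs) rs out b"
    unfolding computes_def
  proof (intro allI impI)
    fix s t :: store assume s: "\<forall>j\<ge>b. s j = 0" "s out = 0"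
    define u where "u ys = (\<lambda>j. if b \<le> j \<and> j < b + length ys then ys ! (j - b) else s j)" for ys
    have u: "(u ys, t) \<in> sem (Seq c2 (clears [b..<b + ?k])) \<longleftrightarrow> (\<exists>z. eval f ys z \<and> t = s(out := z))"
      if "length ys = ?k" for ys
    proof -
      have "map (u ys) [b..<b + ?k] = ys"
        using that by (auto simp: u_def intro!: nth_equalityI)
      moreover have "u ys out = 0" "\<And>j. j \<ge> b + ?k \<Longrightarrow> u ys j = 0"
        using out s that by (auto simp: u_def)
      moreover have "(\<lambda>j. if j \<in> set [b..<b + ?k] then 0 else ((u ys)(out := z)) j) = s(out := z)" for z
        using s that out by (auto simp: u_def fun_eq_iff)
      ultimately show ?thesis
        using computesD[OF c2, of "u ys"] by (auto simp: relcomp_unfold)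
    qed
    have "(s, t) \<in> sem (Seq c1 (Seq c2 (clears [b..<b + ?k]))) \<longleftrightarrow>
      (\<exists>ys. list_all2 (\<lambda>g y. eval g (map s rs) y) gs ys \<and> (u ys, t) \<in> sem (Seq c2 (clears [b..<b + ?k])))"
      using c1[OF s(1)] unfolding sem_iffs(1)[of _ _ c1] u_def by (auto simp del: sem.simps)
    also have "\<dots> \<longleftrightarrow> (\<exists>z. eval (Comp f gs) (map s rs) z \<and> t = s(out := z))"
      unfolding eval_simps using u by (metis list_all2_lengthD)
    finally show "(s, t) \<in> sem (Seq c1 (Seq c2 (clears [b..<b + ?k]))) \<longleftrightarrow> \<dots>" .
  qed
  then show "\<exists>c. computes c (Comp f gs) rs out b" ..
qed

lemma computable_Mu:
  assumes f: "computable f"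
  shows "computable (Mu f)"
  unfolding computable_def
proof (intro allI impI)
  fix rs :: "nat list" and out b :: nat
  assume rs: "set rs \<subseteq> {..<b}" and out: "out < b" "out \<notin> set rs"
  obtain c where c: "computes c f (b # rs) (b + 1) (b + 2)"
    using computableD[OF f, of "b # rs" "b + 2" "b + 1"] rs by fastforce
  \<comment> \<open>Register \<open>b\<close> is the search variable and \<open>b + 1\<close>
    receives the value of \<open>f\<close>. Every completed round certifies a defined, positive
    value, so a zero found after the loop is the least one.\<close>
  let ?body = "Seq c (Seq (Op (Dec (b + 1))) (Seq (clear (b + 1)) (Op (Inc b))))"
  have "computes (Seq (Star ?body) (Seq c (Seq (Op (Zer (b + 1))) (move b out)))) (Mu f) rs out b"
    unfolding computes_def
  proof (intro allI impI)
    fix s t :: store assume s: "\<forall>j\<ge>b. s j = 0" "s out = 0"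
    let ?xs = "map s rs"
    have c': "(s(b := i), t) \<in> sem c \<longleftrightarrow> (\<exists>y. eval f (i # ?xs) y \<and> t = s(b := i, b + 1 := y))" for i t
    proof -
      have "map (s(b := i)) (b # rs) = i # ?xs" using rs by auto
      moreover have "(s(b := i), t) \<in> sem c \<longleftrightarrow>
          (\<exists>y. eval f (map (s(b := i)) (b # rs)) y \<and> t = s(b := i, b + 1 := y))"
        by (rule computesD[OF c]) (use s in auto)
      ultimately show ?thesis by presburger
    qed
    have body: "(s(b := i), t) \<in> sem ?body \<longleftrightarrow> (\<exists>y. eval f (i # ?xs) (Suc y)) \<and> t = s(b := Suc i)" for i t
    proof -
      have "(s(b := i, b + 1 := y), t) \<in> sem (Seq (Op (Dec (b + 1))) (Seq (clear (b + 1)) (Op (Inc b)))) \<longleftrightarrow>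
        y > 0 \<and> t = s(b := Suc i)" for y
      proof -
        have "s(b := i, b + 1 := y, b + 1 := y - 1, b + 1 := 0, b := Suc i) = s(b := Suc i)"
          using s by (auto simp: fun_eq_iff)
        then show ?thesis by (simp add: sem_iffs del: sem.simps)
      qed
      then have "(s(b := i), t) \<in> sem ?body \<longleftrightarrow> (\<exists>y. eval f (i # ?xs) y \<and> y > 0 \<and> t = s(b := Suc i))"
        by (simp only: sem_iffs(1)[of _ _ c] c' ex_chain)
      then show ?thesis by (metis gr0_conv_Suc)
    qed
    have star: "(s, t) \<in> (sem ?body)\<^sup>* \<longleftrightarrow> (\<exists>n. t = s(b := n) \<and> (\<forall>m<n. \<exists>y. eval f (m # ?xs) (Suc y)))" for t
    proof
      assume "(s, t) \<in> (sem ?body)\<^sup>*"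
      then show "\<exists>n. t = s(b := n) \<and> (\<forall>m<n. \<exists>y. eval f (m # ?xs) (Suc y))"
      proof (induction rule: rtrancl_induct)
        case base
        show ?case using s by (intro exI[of _ 0]) auto
      next
        case (step u v)
        then obtain n where n: "u = s(b := n)" "\<forall>m<n. \<exists>y. eval f (m # ?xs) (Suc y)" by blast
        have "(\<exists>y. eval f (n # ?xs) (Suc y)) \<and> v = s(b := Suc n)" using step(2) unfolding n(1) body .
        then show ?case using n(2) by (intro exI[of _ "Suc n"]) (auto simp: less_Suc_eq)
      qed
    next
      assume "\<exists>n. t = s(b := n) \<and> (\<forall>m<n. \<exists>y. eval f (m # ?xs) (Suc y))"
      then obtain n where n: "t = s(b := n)" "\<forall>m<n. \<exists>y. eval f (m # ?xs) (Suc y)" by blast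
      have "(s, s(b := k)) \<in> (sem ?body)\<^sup>*" if "k \<le> n" for k
        using that
      proof (induction k)
        case 0
        then show ?case using s by (simp add: fun_upd_idem)
      next
        case (Suc k)
        have "(s(b := k), s(b := Suc k)) \<in> sem ?body" using n(2) Suc.prems unfolding body by auto
        with Suc.IH Suc.prems show ?case by (meson Suc_leD rtrancl_into_rtrancl)
      qed
      then show "(s, t) \<in> (sem ?body)\<^sup>*" using n(1) by blast
    qed
    have fin: "(s(b := n), t) \<in> sem (Seq c (Seq (Op (Zer (b + 1))) (move b out))) \<longleftrightarrow>
        eval f (n # ?xs) 0 \<and> t = s(out := n)" for n
    proof -
      have "(s(b := n, b + 1 := y), t) \<in> sem (Seq (Op (Zer (b + 1))) (move b out)) \<longleftrightarrow>
          y = 0 \<and> t = s(out := n)" for y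
      proof -
        have "s(b := n, b + 1 := 0, b := 0, out := n) = s(out := n)"
          using s by (auto simp: fun_eq_iff)
        then show ?thesis using s out by (auto simp add: sem_iffs simp del: sem.simps)
      qed
      then show ?thesis
        by (simp only: sem_iffs(1)[of _ _ c] c' ex_chain) blast
    qed
    have "(s, t) \<in> sem (Seq (Star ?body) (Seq c (Seq (Op (Zer (b + 1))) (move b out)))) \<longleftrightarrow>
      (\<exists>n. (\<forall>m<n. \<exists>y. eval f (m # ?xs) (Suc y)) \<and>
        (s(b := n), t) \<in> sem (Seq c (Seq (Op (Zer (b + 1))) (move b out))))"
      unfolding sem_iffs(1)[of _ _ "Star ?body"] sem.simps(4) star by blast
    also have "\<dots> \<longleftrightarrow> (\<exists>y. eval (Mu f) ?xs y \<and> t = s(out := y))"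
      unfolding fin eval_simps by blast
    finally show "(s, t) \<in> sem (Seq (Star ?body) (Seq c (Seq (Op (Zer (b + 1))) (move b out)))) \<longleftrightarrow> \<dots>" .
  qed
  then show "\<exists>c. computes c (Mu f) rs out b" ..
qed

text \<open>A value of a primitive recursion exists only through all earlier ones; this recovers the
  intermediate values that a run passes through.\<close>

lemma PrimRec_downward:
  "eval (PrimRec f g) ((i + k) # xs) z \<Longrightarrow> \<exists>y. eval (PrimRec f g) (i # xs) y"
  by (induction k arbitrary: z) (auto simp: eval_simps)

lemma computable_PrimRec:
  assumes f: "computable f" and g: "computable g"
  shows "computable (PrimRec f g)"
  unfolding computable_def
proof (intro allI impI)
  fix rs :: "nat list" and out b :: nat
  assume rs: "set rs \<subseteq> {..<b}" and out: "out < b" "out \<notin> set rs"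
  show "\<exists>c. computes c (PrimRec f g) rs out b"
  proof (cases rs)
    case Nil
    then have "\<not> eval (PrimRec f g) (map s rs) y" for s y by (auto simp: eval_simps)
    then show ?thesis unfolding computes_def using sem_Fail by (metis empty_iff)
  next
    case (Cons rn rxs)
    have rn: "rn < b" "rn \<noteq> out" and rxs: "set rxs \<subseteq> {..<b}" "out \<notin> set rxs"
      using rs out Cons by auto
    obtain cf where cf: "computes cf f rxs (b + 1) (b + 4)"
      using computableD[OF f, of rxs "b + 4" "b + 1"] rxs by fastforce
    obtain cg where cg: "computes cg g (b # (b + 1) # rxs) (b + 2) (b + 4)"
      using computableD[OF g, of "b # (b + 1) # rxs" "b + 4" "b + 2"] rxs by fastforce
    \<comment> \<open>Register \<open>b\<close> holds the index, \<open>b + 1\<close> the current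
      value, \<open>b + 2\<close> the next value and \<open>b + 3\<close> the number of rounds left.
      Counting down a copy keeps the argument intact.\<close>
    let ?post = "Seq (clear (b + 1)) (Seq (move (b + 2) (b + 1)) (Op (Inc b)))"
    let ?body = "Seq cg ?post"
    let ?fin = "Seq (move (b + 1) out) (clear b)"
    let ?loop = "drain (b + 3) ?body"
    let ?prog = "Seq (copy rn (b + 3) (b + 2)) (Seq cf (Seq ?loop ?fin))"
    have "computes ?prog (PrimRec f g) rs out b"
      unfolding computes_def
    proof (intro allI impI)
      fix s t :: store assume s: "\<forall>j\<ge>b. s j = 0" "s out = 0"
      let ?xs = "map s rxs"
      let ?P = "PrimRec f g"
      define \<sigma> where "\<sigma> n i y = s(b + 3 := n, b := i, b + 1 := y)" for n i y
      have map_\<sigma>: "map (\<sigma> n i y) rxs = ?xs" for n i y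
        using rxs by (auto simp: \<sigma>_def)
      have 1: "(s, t) \<in> sem (copy rn (b + 3) (b + 2)) \<longleftrightarrow> t = \<sigma> (s rn) 0 0" for t
        using rn s by (subst sem_copy) (auto simp: \<sigma>_def fun_eq_iff)
      have 2: "(\<sigma> n 0 0, t) \<in> sem cf \<longleftrightarrow> (\<exists>y. eval f ?xs y \<and> t = \<sigma> n 0 y)" for n t
      proof -
        have "(\<sigma> n 0 0, t) \<in> sem cf \<longleftrightarrow>
            (\<exists>y. eval f (map (\<sigma> n 0 0) rxs) y \<and> t = (\<sigma> n 0 0)(b + 1 := y))"
          by (rule computesD[OF cf]) (use s in \<open>auto simp: \<sigma>_def\<close>)
        then show ?thesis unfolding map_\<sigma> by (simp add: \<sigma>_def)
      qed
      have cg': "(\<sigma> n i y, t) \<in> sem cg \<longleftrightarrow> (\<exists>z. eval g (i # y # ?xs) z \<and> t = (\<sigma> n i y)(b + 2 := z))" for n i y t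
      proof -
        have "map (\<sigma> n i y) (b # (b + 1) # rxs) = i # y # ?xs"
          using map_\<sigma> by (simp add: \<sigma>_def)
        moreover have "(\<sigma> n i y, t) \<in> sem cg \<longleftrightarrow>
            (\<exists>z. eval g (map (\<sigma> n i y) (b # (b + 1) # rxs)) z \<and> t = (\<sigma> n i y)(b + 2 := z))"
          by (rule computesD[OF cg]) (use s in \<open>auto simp: \<sigma>_def\<close>)
        ultimately show ?thesis by presburger
      qed
      have post: "((\<sigma> n i y)(b + 2 := z), t) \<in> sem ?post \<longleftrightarrow> t = \<sigma> n (Suc i) z" for n i y z t
      proof -
        have "((\<sigma> n i y)(b + 2 := z), t) \<in> sem ?post \<longleftrightarrow>
          t = (((\<sigma> n i y)(b + 2 := z))(b + 1 := 0))(b + 2 := 0, b + 1 := z, b := Suc i)"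
          by (simp add: sem_iffs \<sigma>_def del: sem.simps)
        also have "(((\<sigma> n i y)(b + 2 := z))(b + 1 := 0))(b + 2 := 0, b + 1 := z, b := Suc i) = \<sigma> n (Suc i) z"
          using s by (auto simp: \<sigma>_def fun_eq_iff)
        finally show ?thesis .
      qed
      have body: "(\<sigma> n i y, t) \<in> sem ?body \<longleftrightarrow> (\<exists>z. eval g (i # y # ?xs) z \<and> t = \<sigma> n (Suc i) z)" for n i y t
        by (simp only: sem_iffs(1)[of _ _ cg] cg' ex_chain post)
      have dec_body: "(\<sigma> (Suc n) i y, t) \<in> sem (Seq (Op (Dec (b + 3))) ?body) \<longleftrightarrow>
          (\<exists>z. eval g (i # y # ?xs) z \<and> t = \<sigma> n (Suc i) z)" for n i y t
      proof -
        have "(\<sigma> (Suc n) i y)(b + 3 := n) = \<sigma> n i y" "\<sigma> (Suc n) i y (b + 3) = Suc n"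
          by (auto simp: \<sigma>_def fun_eq_iff)
        then have "(\<sigma> (Suc n) i y, u) \<in> sem (Op (Dec (b + 3))) \<longleftrightarrow> u = \<sigma> n i y" for u
          by (simp add: sem_iffs del: sem.simps)
        then show ?thesis by (simp only: sem_iffs(1)[of _ _ "Op (Dec (b + 3))"] simp_thms body)
      qed
      have 3: "(\<sigma> k i y, t) \<in> (sem (Seq (Op (Dec (b + 3))) ?body)) ^^ k \<longleftrightarrow>
          (\<exists>z. eval ?P ((i + k) # ?xs) z \<and> t = \<sigma> 0 (i + k) z)"
        if "eval ?P (i # ?xs) y" for k i y t
        using that
      proof (induction k arbitrary: i y)
        case 0
        then have "eval ?P (i # ?xs) z \<longleftrightarrow> z = y" for z
          using eval_functional by blast
        then show ?case by (simp only: relpow.simps pair_in_Id_conv add_0_right simp_thms eq_commute[of "\<sigma> 0 i y"])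
      next
        case (Suc k)
        have "(\<sigma> (Suc k) i y, t) \<in> (sem (Seq (Op (Dec (b + 3))) ?body)) ^^ Suc k \<longleftrightarrow>
          (\<exists>z. eval g (i # y # ?xs) z \<and> (\<sigma> k (Suc i) z, t) \<in> (sem (Seq (Op (Dec (b + 3))) ?body)) ^^ k)"
          unfolding relpow_Suc_iff dec_body by blast
        also have "\<dots> \<longleftrightarrow> (\<exists>z'. eval g (i # y # ?xs) z' \<and> (\<exists>z. eval ?P ((Suc i + k) # ?xs) z \<and> t = \<sigma> 0 (Suc i + k) z))"
          using Suc.IH Suc.prems by (metis PrimRec_Suc)
        also have "\<dots> \<longleftrightarrow> (\<exists>z. eval ?P ((Suc i + k) # ?xs) z \<and> t = \<sigma> 0 (Suc i + k) z)"
        proof -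
          \<comment> \<open>Existence of the final value must supply the first round. As values are
            unique, the value at index \<open>i\<close> from which it was obtained is
            \<open>y\<close>.\<close>
          have "\<exists>z'. eval g (i # y # ?xs) z'" if "eval ?P ((Suc i + k) # ?xs) z" for z
          proof -
            obtain z' where "eval ?P (Suc i # ?xs) z'" using PrimRec_downward[OF \<open>eval ?P ((Suc i + k) # ?xs) z\<close>] ..
            then obtain y' where "eval ?P (i # ?xs) y'" "eval g (i # y' # ?xs) z'" by (auto simp: eval_simps)
            then show ?thesis using eval_functional[OF Suc.prems] by blast
          qed
          then show ?thesis by blast
        qed
        finally show ?case by simp
      qed
      have loop: "(\<sigma> n 0 y, t) \<in> sem ?loop \<longleftrightarrow> (\<exists>z. eval ?P (n # ?xs) z \<and> t = \<sigma> 0 n z)"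
        if y: "eval f ?xs y" for n y t
      proof -
        have "(\<exists>n i y. t = \<sigma> n i y) \<and> s' (b + 3) = Suc (t (b + 3))"
          if s': "\<exists>n i y. s' = \<sigma> n i y" and st: "(s', t) \<in> sem (Seq (Op (Dec (b + 3))) ?body)" for s' t
        proof -
          obtain n i y where n: "s' = \<sigma> n i y" using s' by blast
          have "n > 0" using st by (auto simp: n \<sigma>_def sem_iffs simp del: sem.simps)
          then obtain m where "n = Suc m" using gr0_conv_Suc by blast
          then obtain z where "t = \<sigma> m (Suc i) z" using st dec_body unfolding n by blast
          then show ?thesis using n \<open>n = Suc m\<close> by (auto simp: \<sigma>_def)
        qed
        then have "(\<sigma> n 0 y, t) \<in> sem ?loop \<longleftrightarrow> (\<sigma> n 0 y, t) \<in> (sem (Seq (Op (Dec (b + 3))) ?body)) ^^ (\<sigma> n 0 y (b + 3))"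
          by (rule sem_drain[where I = "\<lambda>s. \<exists>n i y. s = \<sigma> n i y"]) blast+
        also have "\<sigma> n 0 y (b + 3) = n" by (simp add: \<sigma>_def)
        finally show ?thesis using 3[of 0 y n t] y by (simp add: eval_simps)
      qed
      have fin: "(\<sigma> 0 n z, t) \<in> sem ?fin \<longleftrightarrow> t = s(out := z)" for n z
      proof -
        have "(\<sigma> 0 n z)(b + 1 := 0, out := z, b := 0) = s(out := z)"
          using s out by (auto simp: \<sigma>_def fun_eq_iff)
        then show ?thesis using s out by (simp add: sem_iffs \<sigma>_def del: sem.simps)
      qed
      have "(s, t) \<in> sem ?prog \<longleftrightarrow> (\<exists>y. eval f ?xs y \<and> (\<sigma> (s rn) 0 y, t) \<in> sem (Seq ?loop ?fin))"
        by (simp only: sem_iffs(1)[of _ _ "copy rn (b + 3) (b + 2)"] sem_iffs(1)[of _ _ cf] 1 2 ex_chain simp_thms)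
      also have "\<dots> \<longleftrightarrow> (\<exists>y. eval f ?xs y \<and> (\<exists>z. eval ?P (s rn # ?xs) z \<and> t = s(out := z)))"
        by (simp only: sem_iffs(1)[of _ _ ?loop] loop fin ex_chain cong: conj_cong)
      \<comment> \<open>The value at \<open>0\<close> exists whenever the value at
        \<open>s rn\<close> does.\<close>
      also have "\<dots> \<longleftrightarrow> (\<exists>z. eval ?P (s rn # ?xs) z \<and> t = s(out := z))"
        using PrimRec_downward[of f g 0 "s rn" ?xs] by (auto simp: eval_simps)
      finally show "(s, t) \<in> sem ?prog \<longleftrightarrow> (\<exists>y. eval ?P (map s rs) y \<and> t = s(out := y))"
        by (simp add: Cons del: sem.simps)
    qed
    then show ?thesis ..
  qed
qed

theorem computable_recf: "computable f"
  by (induction f) (auto intro: computable_Zero computable_Succ computable_Proj computable_Comp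
    computable_PrimRec computable_Mu)

section \<open>Total recursive functions\<close>

text \<open>Taking the arguments as one list lets composite expressions in \<open>xs ! i\<close> be
  treated by syntax-directed introduction rules.\<close>

definition total :: "nat \<Rightarrow> (nat list \<Rightarrow> nat) \<Rightarrow> bool" where
  "total k F \<longleftrightarrow> (\<exists>f. \<forall>xs. length xs = k \<longrightarrow> eval f xs (F xs))"

definition total1 :: "(nat \<Rightarrow> nat) \<Rightarrow> bool" where
  "total1 h \<longleftrightarrow> (\<exists>f. \<forall>x. eval f [x] (h x))"

definition total2 :: "(nat \<Rightarrow> nat \<Rightarrow> nat) \<Rightarrow> bool" where
  "total2 h \<longleftrightarrow> (\<exists>f. \<forall>x y. eval f [x, y] (h x y))"

lemma total_app1: "total1 h \<Longrightarrow> total k F \<Longrightarrow> total k (\<lambda>xs. h (F xs))"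
proof -
  assume "total1 h" "total k F"
  then obtain f g where f: "\<And>x. eval f [x] (h x)" and g: "\<And>xs. length xs = k \<Longrightarrow> eval g xs (F xs)"
    unfolding total_def total1_def by blast
  have "eval (Comp f [g]) xs (h (F xs))" if "length xs = k" for xs
    by (rule Comp[where ys = "[F xs]"]) (use f g that in auto)
  then show ?thesis unfolding total_def by blast
qed

lemma total_app2: "total2 h \<Longrightarrow> total k F \<Longrightarrow> total k G \<Longrightarrow> total k (\<lambda>xs. h (F xs) (G xs))"
proof -
  assume "total2 h" "total k F" "total k G"
  then obtain f g g' where f: "\<And>x y. eval f [x, y] (h x y)"
    and g: "\<And>xs. length xs = k \<Longrightarrow> eval g xs (F xs)" "\<And>xs. length xs = k \<Longrightarrow> eval g' xs (G xs)"
    unfolding total_def total2_def by blast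
  have "eval (Comp f [g, g']) xs (h (F xs) (G xs))" if "length xs = k" for xs
    by (rule Comp[where ys = "[F xs, G xs]"]) (use f g that in auto)
  then show ?thesis unfolding total_def by blast
qed

lemma total_nth: "i < k \<Longrightarrow> total k (\<lambda>xs. xs ! i)"
  unfolding total_def by (intro exI[of _ "Proj i"]) (auto intro: Proj)

lemma total1_Suc: "total1 Suc"
  unfolding total1_def by (intro exI[of _ Succ]) (auto intro: Succ)

lemma total_const: "total k (\<lambda>_. c)"
proof (induction c)
  case 0
  show ?case unfolding total_def by (intro exI[of _ Zero]) (auto intro: eval.Zero)
next
  case (Suc c)
  show ?case using total_app1[OF total1_Suc Suc] .
qed

lemma total1_rec:
  assumes "total 2 (\<lambda>xs. G (xs ! 0) (xs ! 1))" "\<And>n. h (Suc n) = G n (h n)"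
  shows "total1 h"
proof -
  obtain f where f: "\<And>xs. length xs = 0 \<Longrightarrow> eval f xs (h 0)"
    using total_const[of 0 "h 0"] unfolding total_def by blast
  obtain g where g: "\<And>xs. length xs = 2 \<Longrightarrow> eval g xs (G (xs ! 0) (xs ! 1))"
    using assms(1) unfolding total_def by blast
  have "eval (PrimRec f g) [n] (h n)" for n
  proof (induction n)
    case 0
    show ?case using f[of "[]"] by (simp add: PrimRec_0)
  next
    case (Suc n)
    show ?case using PrimRec_Suc[OF Suc, of "h (Suc n)"] g[of "[n, h n]"] assms(2) by simp
  qed
  then show ?thesis unfolding total1_def by blast
qed

lemma total2_rec:
  assumes "total 1 (\<lambda>xs. F (xs ! 0))" "total 3 (\<lambda>xs. G (xs ! 0) (xs ! 1) (xs ! 2))"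
    and "\<And>y. h 0 y = F y" "\<And>n y. h (Suc n) y = G n (h n y) y"
  shows "total2 h"
proof -
  obtain f where f: "\<And>xs. length xs = 1 \<Longrightarrow> eval f xs (F (xs ! 0))"
    using assms(1) unfolding total_def by blast
  obtain g where g: "\<And>xs. length xs = 3 \<Longrightarrow> eval g xs (G (xs ! 0) (xs ! 1) (xs ! 2))"
    using assms(2) unfolding total_def by blast
  have "eval (PrimRec f g) [n, y] (h n y)" for n y
  proof (induction n)
    case 0
    show ?case using f[of "[y]"] assms(3) by (simp add: PrimRec_0)
  next
    case (Suc n)
    show ?case using PrimRec_Suc[OF Suc, of "h (Suc n) y"] g[of "[n, h n y, y]"] assms(4) by simp
  qed
  then show ?thesis unfolding total2_def by blast
qed

lemmas total_basic = total_const total_nth total_app1[OF total1_Suc]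

lemma total2_plus: "total2 (+)"
  by (rule total2_rec[where F = "\<lambda>y. y" and G = "\<lambda>n z y. Suc z"]) (auto intro!: total_basic)

lemmas total_plus = total_app2[OF total2_plus]

lemma total2_times: "total2 (*)"
  by (rule total2_rec[where F = "\<lambda>y. 0" and G = "\<lambda>n z y. y + z"]) (auto intro!: total_basic total_plus)

lemmas total_times = total_app2[OF total2_times]

lemma total1_pred: "total1 (\<lambda>n. n - 1)"
  by (rule total1_rec[where G = "\<lambda>n z. n"]) (auto intro!: total_basic)

lemma total_diff:
  assumes "total k F" "total k G"
  shows "total k (\<lambda>xs. F xs - G xs)"
proof -
  \<comment> \<open>Recursion runs over the first argument, so the subtrahend comes first and the
    arguments are swapped afterwards.\<close>
  have "total2 (\<lambda>n y. y - n)"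
    by (rule total2_rec[where F = "\<lambda>y. y" and G = "\<lambda>n z y. z - 1"])
      (auto intro!: total_basic total_app1[OF total1_pred, simplified])
  from total_app2[OF this assms(2,1)] show ?thesis .
qed

lemma total_power:
  assumes "total k F"
  shows "total k (\<lambda>xs. c ^ F xs)"
proof -
  have "total1 (\<lambda>n. c ^ n)"
    by (rule total1_rec[where G = "\<lambda>n z. c * z"]) (auto intro!: total_basic total_times)
  from total_app1[OF this assms] show ?thesis .
qed

lemma total_prod_encode:
  assumes "total k F" "total k G"
  shows "total k (\<lambda>xs. prod_encode (F xs, G xs))"
proof -
  have "total1 triangle"
    by (rule total1_rec[where G = "\<lambda>n z. z + Suc n"]) (auto intro!: total_basic total_plus)
  from total_plus[OF total_app1[OF this total_plus[OF assms]] assms(1)]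
  show ?thesis by (simp add: prod_encode_def)
qed

lemmas total_intros = total_basic total_plus total_times total_diff total_power total_prod_encode

text \<open>Putting fixed letters in front of a coded list uses only pairing and successor; no
  decoding has to be computed.\<close>

lemma total_code_append:
  assumes "total k F"
  shows "total k (\<lambda>xs. list_encode (u @ list_decode (F xs)))"
proof (induction u)
  case Nil
  then show ?case using assms by simp
next
  case (Cons a u)
  have "total k (\<lambda>xs. Suc (prod_encode (a, list_encode (u @ list_decode (F xs)))))"
    by (intro total_intros Cons)
  then show ?case by simp
qed

lemma total_code_repeat:
  assumes "total k F"
  shows "total k (\<lambda>xs. list_encode (concat (replicate (F xs) u) @ v))"
proof -
  have "total1 (\<lambda>n. list_encode (concat (replicate n u) @ v))"
    by (rule total1_rec[where G = "\<lambda>n z. list_encode (u @ list_decode z)"])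
      (auto intro!: total_code_append total_basic)
  from total_app1[OF this assms] show ?thesis .
qed

lemma total_computable:
  assumes F: "total (length rs) F" and rs: "set rs \<subseteq> {..<b}" "out < b" "out \<notin> set rs"
  shows "\<exists>c. \<forall>s. (\<forall>j\<ge>b. s j = 0) \<longrightarrow> s out = 0 \<longrightarrow> (\<forall>t. (s, t) \<in> sem c \<longleftrightarrow> t = s(out := F (map s rs)))"
proof -
  obtain f where f: "\<And>xs. length xs = length rs \<Longrightarrow> eval f xs (F xs)"
    using F unfolding total_def by blast
  have *: "eval f (map s rs) y \<longleftrightarrow> y = F (map s rs)" for s y
    using f[of "map s rs"] eval_functional by fastforce
  obtain c where "computes c f rs out b"
    using computableD[OF computable_recf rs] by blast
  then show ?thesis unfolding computes_def * by auto
qed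

text \<open>Each loop may stop at any time, so registers that start at zero receive arbitrary
  values: an existential quantifier as a program.\<close>

fun guess :: "nat list \<Rightarrow> cmd" where
  "guess [] = Op Nop"
| "guess (r # rs) = Seq (Star (Op (Inc r))) (guess rs)"

lemma sem_star_Inc: "(s, t) \<in> (sem (Op (Inc r)))\<^sup>* \<longleftrightarrow> (\<exists>k. t = s(r := s r + k))"
proof
  assume "(s, t) \<in> (sem (Op (Inc r)))\<^sup>*"
  then show "\<exists>k. t = s(r := s r + k)"
  proof (induction rule: rtrancl_induct)
    case base
    then show ?case by (intro exI[of _ 0]) simp
  next
    case (step u v)
    then obtain k where "u = s(r := s r + k)" by blast
    then have "v = s(r := s r + Suc k)" using step(2) by (simp add: sem_iffs del: sem.simps)
    then show ?case by blast
  qed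
next
  have "(s, s(r := s r + k)) \<in> (sem (Op (Inc r)))\<^sup>*" for k
  proof (induction k)
    case (Suc k)
    have "(s(r := s r + k), s(r := s r + Suc k)) \<in> sem (Op (Inc r))"
      by (simp add: sem_iffs del: sem.simps)
    with Suc show ?case by (rule rtrancl_into_rtrancl)
  qed simp
  then show "\<exists>k. t = s(r := s r + k) \<Longrightarrow> (s, t) \<in> (sem (Op (Inc r)))\<^sup>*" by blast
qed

lemma sem_guess:
  assumes "distinct rs" "\<forall>r\<in>set rs. s r = 0"
  shows "(s, t) \<in> sem (guess rs) \<longleftrightarrow> (\<forall>j. j \<notin> set rs \<longrightarrow> t j = s j)"
  using assms
proof (induction rs arbitrary: s)
  case Nil
  then show ?case by auto
next
  case (Cons r rs)
  have "(s, t) \<in> sem (guess (r # rs)) \<longleftrightarrow> (\<exists>k. (s(r := k), t) \<in> sem (guess rs))"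
    using Cons.prems(2) by (auto simp: sem_iffs(1) sem_star_Inc sem.simps(4) simp del: sem.simps(1,2))
  also have "\<dots> \<longleftrightarrow> (\<exists>k. \<forall>j. j \<notin> set rs \<longrightarrow> t j = (s(r := k)) j)"
    using Cons by simp
  also have "\<dots> \<longleftrightarrow> (\<forall>j. j \<notin> set (r # rs) \<longrightarrow> t j = s j)"
    by auto
  finally show ?case .
qed

section \<open>A universal program and undecidability\<close>

definition rule_code :: "nat \<times> nat \<times> nat \<times> nat \<Rightarrow> nat" where
  "rule_code = (\<lambda>(m, r, a, b). prod_encode (prod_encode (m, r), prod_encode (a, b)))"

definition rules_of :: "nat \<Rightarrow> (nat \<times> nat \<times> nat \<times> nat) set" where
  "rules_of n = {R. rule_code R \<in> set_decode n}"

lemma inj_rule_code: "inj rule_code"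
  by (auto simp: rule_code_def inj_def prod_encode_eq)

lemma rules_of_surj: "finite R \<Longrightarrow> \<exists>n. rules_of n = R"
  by (intro exI[of _ "set_encode (rule_code ` R)"])
    (auto simp: rules_of_def set_encode_inverse inj_image_mem_iff[OF inj_rule_code])

text \<open>Splits \<open>n\<close> at its binary digit \<open>h\<close>, which must be
  \<open>1\<close>: \<open>u\<close> and \<open>v\<close> are the digits above and below, and the
  slack \<open>w\<close> expresses \<open>v < 2 ^ h\<close>. This leaves equations in sums, products
  and powers, without division.\<close>

lemma mem_set_decode_iff:
  "h \<in> set_decode n \<longleftrightarrow> (\<exists>u v w. n = 2 ^ h * (2 * u + 1) + v \<and> v + w + 1 = 2 ^ h)"
proof
  assume "h \<in> set_decode n"
  then have "odd (n div 2 ^ h)" by (simp add: set_decode_def)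
  then obtain u where u: "n div 2 ^ h = 2 * u + 1" by (rule oddE)
  have "k < l \<Longrightarrow> k + (l - k - 1) + 1 = l" for k l :: nat by simp
  then have "n mod 2 ^ h + (2 ^ h - n mod 2 ^ h - 1) + 1 = 2 ^ h" by (metis mod_less_divisor zero_less_numeral zero_less_power)
  moreover have "n = 2 ^ h * (2 * u + 1) + n mod 2 ^ h" using u by (metis mult_div_mod_eq)
  ultimately show "\<exists>u v w. n = 2 ^ h * (2 * u + 1) + v \<and> v + w + 1 = 2 ^ h" by blast
next
  assume "\<exists>u v w. n = 2 ^ h * (2 * u + 1) + v \<and> v + w + 1 = 2 ^ h"
  then obtain u v w where n: "n = 2 ^ h * (2 * u + 1) + v" and v: "v + w + 1 = 2 ^ h" by blast
  have "v < 2 ^ h" unfolding v[symmetric] by simp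
  moreover have "(v + 2 ^ h * (2 * u + 1)) div 2 ^ h = 2 * u + 1 + v div 2 ^ h"
    by (rule div_mult_self2) simp
  ultimately have "n div 2 ^ h = 2 * u + 1" unfolding n by (simp only: add.commute[of _ v] div_less add_0_right)
  then show "h \<in> set_decode n" by (simp add: set_decode_def)
qed

text \<open>The distance of two numbers; a sum of such terms is \<open>0\<close> iff all the
  equations hold.\<close>

definition disagree :: "nat \<Rightarrow> nat \<Rightarrow> nat" where
  "disagree u v = (u - v) + (v - u)"

lemma disagree_eq_0 [simp]: "disagree u v = 0 \<longleftrightarrow> u = v"
  by (auto simp: disagree_def)

text \<open>Positions \<open>0\<close>, \<open>1\<close> and \<open>2\<close> hold the code of the rule system and the values before and after a step;
  the others hold a rule \<open>(m, r, a, b)\<close>, the multiplier \<open>y\<close> and the witnesses \<open>u\<close>, \<open>v\<close>, \<open>w\<close> of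
  \<open>mem_set_decode_iff\<close>.\<close>

definition step_check :: "nat list \<Rightarrow> nat" where
  "step_check xs = (let h = prod_encode (prod_encode (xs ! 3, xs ! 4), prod_encode (xs ! 5, xs ! 6)) in
    disagree (xs ! 0) (2 ^ h * (2 * xs ! 8 + 1) + xs ! 9) + disagree (xs ! 9 + xs ! 10 + 1) (2 ^ h) +
    disagree (xs ! 1) (xs ! 3 * xs ! 7 + xs ! 4) + disagree (xs ! 2) (xs ! 5 * xs ! 7 + xs ! 6))"

lemma total_step_check: "total 11 step_check"
  unfolding step_check_def disagree_def Let_def by (intro total_intros) simp_all

lemma astep_rules_of_iff:
  "(x, x') \<in> astep (rules_of n) \<longleftrightarrow> (\<exists>m r a b y u v w. step_check [n, x, x', m, r, a, b, y, u, v, w] = 0)"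
  by (simp add: astep_def rules_of_def mem_set_decode_iff step_check_def Let_def rule_code_def nth_Cons') blast

section \<open>A program that interprets rule systems\<close>

definition pair_store :: "nat \<Rightarrow> nat \<Rightarrow> store" where
  "pair_store n x = (\<lambda>_. 0)(0 := n, 1 := x)"

lemma ex_interpreter_step:
  "\<exists>c. \<forall>n x t. (pair_store n x, t) \<in> sem c \<longleftrightarrow> (\<exists>x'. t = pair_store n x' \<and> (x, x') \<in> astep (rules_of n))"
proof -
  have "\<exists>c. \<forall>s. (\<forall>j\<ge>12. s j = 0) \<longrightarrow> s 11 = 0 \<longrightarrow>
      (\<forall>t. (s, t) \<in> sem c \<longleftrightarrow> t = s(11 := step_check (map s [0..<11])))"
    by (rule total_computable) (use total_step_check in auto)
  then obtain c where c: "\<And>s t. (\<forall>j\<ge>12. s j = 0) \<Longrightarrow> s 11 = 0 \<Longrightarrow>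
      (s, t) \<in> sem c \<longleftrightarrow> t = s(11 := step_check (map s [0..<11]))" by blast
  let ?tail = "Seq (Op (Zer 11)) (Seq (clear 1) (Seq (move 2 1) (clears [3..<11])))"
  \<comment> \<open>The successor in register \<open>2\<close> and the witnesses in \<open>3\<close>
    to \<open>10\<close> are guessed; \<open>Zer 11\<close> discards guesses that fail the check.
    Then the successor replaces the old value and the witnesses are erased, so the step can be
    repeated.\<close>
  let ?c = "Seq (guess [2..<11]) (Seq c ?tail)"
  have "(pair_store n x, t) \<in> sem ?c \<longleftrightarrow> (\<exists>x'. t = pair_store n x' \<and> (x, x') \<in> astep (rules_of n))" for n x t
  proof -
    let ?s = "pair_store n x"
    let ?ext = "\<lambda>u. \<forall>j. j \<notin> {2..<11} \<longrightarrow> u j = ?s j"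
    have guess: "(?s, u) \<in> sem (guess [2..<11]) \<longleftrightarrow> ?ext u" for u
    proof -
      have "\<forall>r\<in>set [2..<11]. ?s r = 0"
        unfolding set_upt by (simp add: pair_store_def)
      from sem_guess[OF distinct_upt this] show ?thesis unfolding set_upt .
    qed
    have tail: "(u, t) \<in> sem (Seq c ?tail) \<longleftrightarrow> step_check (map u [0..<11]) = 0 \<and> t = pair_store n (u 2)"
      if u: "?ext u" for u
    proof -
      have u0: "u 11 = 0" "\<forall>j\<ge>12. u j = 0" using u by (auto simp: pair_store_def)
      define z where "z = step_check (map u [0..<11])"
      let ?v = "u(11 := z, 1 := 0)"
      let ?w = "\<lambda>j. if j \<in> set [3..<11] then 0 else (?v(2 := 0, 1 := ?v 1 + ?v 2)) j"
      have fin: "?w = pair_store n (u 2)" if "z = 0"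
      proof
        fix j :: nat
        consider "j \<in> {3..<11}" | "j = 0" | "j = 1" | "j = 2" | "j = 11" | "j > 11" by fastforce
        then show "?w j = pair_store n (u 2) j"
          unfolding set_upt by cases (use u that in \<open>auto simp: pair_store_def\<close>)
      qed
      have "(2::nat) \<noteq> 1" by simp
      note move = sem_move[OF this]
      have "(u(11 := z), t) \<in> sem ?tail \<longleftrightarrow> (u(11 := z)) 11 = 0 \<and>
          (u(11 := z), t) \<in> sem (Seq (clear 1) (Seq (move 2 1) (clears [3..<11])))"
        unfolding sem_iffs(1)[of _ _ "Op (Zer 11)"] sem_iffs(4) by blast
      also have "\<dots> \<longleftrightarrow> z = 0 \<and> t = ?w"
        unfolding sem_iffs(1) sem_clear move sem_clears fun_upd_same simp_thms ..
      also have "\<dots> \<longleftrightarrow> z = 0 \<and> t = pair_store n (u 2)"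
      proof (rule conj_cong[OF refl])
        assume "z = 0"
        show "t = ?w \<longleftrightarrow> t = pair_store n (u 2)" unfolding fin[OF \<open>z = 0\<close>] ..
      qed
      finally have "(u(11 := z), t) \<in> sem ?tail \<longleftrightarrow> z = 0 \<and> t = pair_store n (u 2)" .
      moreover have "(u, t) \<in> sem (Seq c ?tail) \<longleftrightarrow> (u(11 := z), t) \<in> sem ?tail"
        unfolding z_def by (simp only: sem_iffs(1)[of _ _ c] c[OF u0(2,1)] simp_thms)
      ultimately show ?thesis by (simp only: z_def)
    qed
    have "(?s, t) \<in> sem ?c \<longleftrightarrow> (\<exists>u. ?ext u \<and> step_check (map u [0..<11]) = 0 \<and> t = pair_store n (u 2))"
      unfolding sem_iffs(1)[of _ _ "guess [2..<11]"] guess using tail by blast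
    also have "\<dots> \<longleftrightarrow> (\<exists>x'. t = pair_store n x' \<and> (x, x') \<in> astep (rules_of n))"
    proof
      assume "\<exists>u. ?ext u \<and> step_check (map u [0..<11]) = 0 \<and> t = pair_store n (u 2)"
      then obtain u where u: "?ext u" "step_check (map u [0..<11]) = 0" "t = pair_store n (u 2)" by blast
      have "map u [0..<11] = [u 0, u 1, u 2, u 3, u 4, u 5, u 6, u 7, u 8, u 9, u 10]"
        by (simp add: upt_rec numeral_eq_Suc)
      moreover have "u 0 = n" "u 1 = x" using u(1) by (auto simp: pair_store_def)
      ultimately have "step_check [n, x, u 2, u 3, u 4, u 5, u 6, u 7, u 8, u 9, u 10] = 0"
        using u(2) by simp
      then show "\<exists>x'. t = pair_store n x' \<and> (x, x') \<in> astep (rules_of n)"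
        unfolding astep_rules_of_iff using u(3) by blast
    next
      assume "\<exists>x'. t = pair_store n x' \<and> (x, x') \<in> astep (rules_of n)"
      then obtain x' m r a b y u v w where t: "t = pair_store n x'"
        and chk: "step_check [n, x, x', m, r, a, b, y, u, v, w] = 0"
        unfolding astep_rules_of_iff by blast
      define l where "l = (\<lambda>j. if j < 11 then [n, x, x', m, r, a, b, y, u, v, w] ! j else 0)"
      have "?ext l"
      proof (intro allI impI)
        fix j assume "j \<notin> {2..<11::nat}"
        then consider "j = 0" | "j = 1" | "j \<ge> 11" by fastforce
        then show "l j = ?s j" by cases (auto simp: l_def pair_store_def)
      qed
      moreover have "map l [0..<11] = [n, x, x', m, r, a, b, y, u, v, w]"
        by (rule nth_equalityI) (auto simp: l_def)
      moreover have "l 2 = x'" by (simp add: l_def)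
      ultimately show "\<exists>u. ?ext u \<and> step_check (map u [0..<11]) = 0 \<and> t = pair_store n (u 2)"
        using chk t by metis
    qed
    finally show ?thesis .
  qed
  then show ?thesis by blast
qed

text \<open>The number \<open>n\<close> serves both as the code of the rule system and as its input,
  which is the form the diagonal argument needs.\<close>

lemma ex_universal:
  "\<exists>c. \<forall>n. (init n, \<lambda>_. 0) \<in> sem c \<longleftrightarrow> (inp n, 1) \<in> (astep (rules_of n))\<^sup>*"
proof -
  obtain step where interp: "\<And>n x t. (pair_store n x, t) \<in> sem step \<longleftrightarrow>
      (\<exists>x'. t = pair_store n x' \<and> (x, x') \<in> astep (rules_of n))"
    using ex_interpreter_step by blast
  have "total 1 (\<lambda>xs. inp (xs ! 0))"
    unfolding inp_def by (intro total_intros) simp_all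
  then have "\<exists>c. \<forall>s. (\<forall>j\<ge>2. s j = 0) \<longrightarrow> s 1 = 0 \<longrightarrow>
      (\<forall>t. (s, t) \<in> sem c \<longleftrightarrow> t = s(1 := inp (map s [0] ! 0)))"
    by (intro total_computable) auto
  then obtain c where c: "\<And>s t. (\<forall>j\<ge>2. s j = 0) \<Longrightarrow> s 1 = 0 \<Longrightarrow>
      (s, t) \<in> sem c \<longleftrightarrow> t = s(1 := inp (map s [0] ! 0))" by blast
  have start: "(init n, t) \<in> sem c \<longleftrightarrow> t = pair_store n (inp n)" for n t
    by (subst c) (auto simp: init_def pair_store_def)
  have star: "(pair_store n x, t) \<in> (sem step)\<^sup>* \<longleftrightarrow>
      (\<exists>x'. (x, x') \<in> (astep (rules_of n))\<^sup>* \<and> t = pair_store n x')" for n x t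
  proof
    assume "(pair_store n x, t) \<in> (sem step)\<^sup>*"
    then show "\<exists>x'. (x, x') \<in> (astep (rules_of n))\<^sup>* \<and> t = pair_store n x'"
    proof (induction rule: rtrancl_induct)
      case base
      then show ?case by blast
    next
      case (step u v)
      then show ?case using interp by (meson rtrancl_into_rtrancl)
    qed
  next
    assume "\<exists>x'. (x, x') \<in> (astep (rules_of n))\<^sup>* \<and> t = pair_store n x'"
    then obtain x' where "(x, x') \<in> (astep (rules_of n))\<^sup>*" and t: "t = pair_store n x'" by blast
    from this(1) show "(pair_store n x, t) \<in> (sem step)\<^sup>*" unfolding t
    proof (induction rule: rtrancl_induct)
      case (step y z)
      then have "(pair_store n y, pair_store n z) \<in> sem step" using interp by blast
      with step.IH show ?case by (rule rtrancl_into_rtrancl)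
    qed blast
  qed
  \<comment> \<open>Passes only if register \<open>1\<close> holds exactly \<open>1\<close>. The
    code in register \<open>0\<close> is erased because acceptance means ending in the zero
    store.\<close>
  let ?fin = "Seq (Op (Dec 1)) (Seq (Op (Zer 1)) (clear 0))"
  have fin: "(pair_store n x, \<lambda>_. 0) \<in> sem ?fin \<longleftrightarrow> x = 1" for n x
  proof -
    let ?s = "pair_store n x"
    have "(?s, \<lambda>_. 0) \<in> sem ?fin \<longleftrightarrow>
        ?s 1 > 0 \<and> (?s(1 := ?s 1 - 1)) 1 = 0 \<and> (\<lambda>_. 0) = ?s(1 := ?s 1 - 1, 0 := 0)"
      unfolding sem_iffs sem_clear by blast
    then show ?thesis by (auto simp: pair_store_def fun_eq_iff)
  qed
  have "(init n, \<lambda>_. 0) \<in> sem (Seq c (Seq (Star step) ?fin)) \<longleftrightarrow> (inp n, 1) \<in> (astep (rules_of n))\<^sup>*" for n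
    by (simp only: sem_iffs(1)[of _ _ c] sem_iffs(1)[of _ _ "Star step"] sem.simps(4) start star ex_chain fin simp_thms) blast
  then show ?thesis by blast
qed

section \<open>Words for group elements and the diagonal argument\<close>

lemma word_value_append:
  assumes "group G" "set gs \<subseteq> carrier G" "u \<in> lists {..<length gs}" "v \<in> lists {..<length gs}"
  shows "word_value G gs (u @ v) = word_value G gs u \<otimes>\<^bsub>G\<^esub> word_value G gs v"
    and "word_value G gs v \<in> carrier G"
proof -
  interpret group G by fact
  have carr: "gs ! i \<in> carrier G" if "i < length gs" for i
    using assms(2) that by auto
  have closed: "word_value G gs w \<in> carrier G" if "w \<in> lists {..<length gs}" for w
    using that by (induction w) (auto simp: word_value_def carr)
  show "word_value G gs v \<in> carrier G" using closed assms(4) .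
  show "word_value G gs (u @ v) = word_value G gs u \<otimes>\<^bsub>G\<^esub> word_value G gs v"
    using assms(3)
  proof (induction u)
    case Nil
    then show ?case using closed[OF assms(4)] by (simp add: word_value_def)
  next
    case (Cons i u)
    then have "gs ! i \<in> carrier G" "word_value G gs u \<in> carrier G" using carr closed by auto
    then show ?case
      using Cons closed[OF assms(4)] by (simp add: word_value_def m_assoc)
  qed
qed

lemma ex_word:
  assumes G: "group G" and gs: "generator_list G gs" and x: "x \<in> carrier G"
  shows "\<exists>w\<in>lists {..<length gs}. word_value G gs w = x"
proof -
  interpret group G by fact
  have sub: "set gs \<subseteq> carrier G" and inv: "\<And>x. x \<in> set gs \<Longrightarrow> inv\<^bsub>G\<^esub> x \<in> set gs"
    and gen: "generate G (set gs) = carrier G"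
    using gs by (auto simp: generator_list_def)
  have single: "\<exists>w\<in>lists {..<length gs}. word_value G gs w = h" if h: "h \<in> set gs" for h
  proof -
    obtain i where "i < length gs" "gs ! i = h" using h by (auto simp: in_set_conv_nth)
    then show ?thesis using h sub by (intro bexI[of _ "[i]"]) (auto simp: word_value_def)
  qed
  have "x \<in> generate G (set gs)" using x gen by simp
  then show ?thesis
  proof (induction rule: generate.induct)
    case one
    show ?case by (intro bexI[of _ "[]"]) (auto simp: word_value_def)
  next
    case (eng h1 h2)
    then obtain u v where "u \<in> lists {..<length gs}" "v \<in> lists {..<length gs}"
      "word_value G gs u = h1" "word_value G gs v = h2" by blast
    then show ?case
      using word_value_append(1)[OF G sub, of u v] by (intro bexI[of _ "u @ v"]) auto
  qed (use single inv in auto)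
qed

theorem theorem6:
  shows "\<exists>M. fin_gen_submonoid (integer_group \<wr> integer_group) M \<and>
    \<not> decidable_membership (integer_group \<wr> integer_group) M"
proof -
  obtain univ where univ: "\<And>n. (init n, \<lambda>_. 0) \<in> sem univ \<longleftrightarrow> (inp n, 1) \<in> (astep (rules_of n))\<^sup>*"
    using ex_universal by blast
  obtain rs where rs: "set rs = rules univ"
    using finite_list[OF finite_rules] by blast
  \<comment> \<open>The submonoid is \<open>simulator\<close> for the rules of the universal
    program, hence independent of \<open>n\<close>.\<close>
  interpret affine_system rs
    by standard (use rs rules_pos in blast)
  define P where "P n \<longleftrightarrow> (inp n, 1) \<in> (astep (rules_of n))\<^sup>*" for n
  have target_mem: "target (inp n) \<in> simulator \<longleftrightarrow> P n" for n
    unfolding target_in_simulator_iff rs rules_correct univ P_def ..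
  have "\<not> decidable_membership ZZ simulator"
  proof
    assume "decidable_membership ZZ simulator"
    then obtain gs f where gs: "generator_list ZZ gs"
      and f: "\<And>w. w \<in> lists {..<length gs} \<Longrightarrow>
        eval f [list_encode w] (if word_value ZZ gs w \<in> simulator then 1 else 0)"
      unfolding decidable_membership_def decidable_language_def by auto
    have sub: "set gs \<subseteq> carrier ZZ" using gs by (simp add: generator_list_def)
    \<comment> \<open>Chosen so that \<open>target x\<close> is \<open>u\<close> taken
      \<open>x\<close> times, followed by \<open>v\<close>. Fixed words for \<open>u\<close> and
      \<open>v\<close> over the given generators yield a word for every \<open>target x\<close>,
      computably in \<open>x\<close> for \<open>x = inp n\<close>.\<close>
    define u v :: "(int \<Rightarrow> int) \<times> int" where "u = (\<lambda>p. - delta 0 p, 0)" and "v = (delta 3, 2)"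
    have "finite {p. delta k p \<noteq> 0}" for k
      by (rule finite_subset[of _ "{k}"]) (auto simp: delta_def)
    then have "u \<in> carrier ZZ" "v \<in> carrier ZZ"
      by (auto simp: u_def v_def carrier_ZZ)
    then obtain wu wv where wu: "wu \<in> lists {..<length gs}" "word_value ZZ gs wu = u"
      and wv: "wv \<in> lists {..<length gs}" "word_value ZZ gs wv = v"
      using ex_word[OF group_ZZ gs] by metis
    define W where "W x = concat (replicate x wu) @ wv" for x
    have W: "W x \<in> lists {..<length gs} \<and> word_value ZZ gs (W x) = target x" for x
    proof (induction x)
      case 0
      then show ?case using wv by (simp add: W_def v_def target_def)
    next
      case (Suc x)
      have "W (Suc x) = wu @ W x" by (simp add: W_def)
      moreover have "u \<otimes>\<^bsub>ZZ\<^esub> target x = target (Suc x)"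
        by (auto simp: u_def target_def mult_ZZ algebra_simps)
      ultimately show ?case
        using Suc wu word_value_append(1)[OF group_ZZ sub wu(1), of "W x"] by simp
    qed
    have "total 1 (\<lambda>xs. list_encode (W (inp (xs ! 0))))"
      unfolding W_def inp_def by (intro total_code_repeat total_intros) simp_all
    then obtain w where w: "\<And>xs. length xs = 1 \<Longrightarrow> eval w xs (list_encode (W (inp (xs ! 0))))"
      unfolding total_def by blast
    define d where "d = Comp f [w]"
    have d: "eval d [n] (if P n then 1 else 0)" for n
      unfolding d_def
      by (rule Comp[where ys = "[list_encode (W (inp n))]"])
        (use w[of "[n]"] f[of "W (inp n)"] W[of "inp n"] target_mem in simp_all)
    \<comment> \<open>A search whose test ignores the search variable: it stops at once if
      \<open>P n\<close> fails and never if \<open>P n\<close> holds. \<open>Proj 1\<close> selects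
      \<open>n\<close>, since the search variable comes first.\<close>
    define D where "D = Mu (Comp d [Proj 1])"
    have d': "eval (Comp d [Proj 1]) [i, n] (if P n then 1 else 0)" for i n
      by (rule Comp[where ys = "[n]"]) (use d Proj[of 1 "[i, n]"] in simp_all)
    have D: "(\<exists>y. eval D [n] y) \<longleftrightarrow> \<not> P n" for n
    proof
      assume "\<exists>y. eval D [n] y"
      then obtain y where "eval (Comp d [Proj 1]) [y, n] 0" by (auto simp: D_def eval_simps(8))
      from eval_functional[OF this d'] show "\<not> P n" by (auto split: if_splits)
    next
      assume "\<not> P n"
      then have "eval (Comp d [Proj 1]) [0, n] 0" using d'[of 0 n] by simp
      then have "eval D [n] 0" unfolding D_def by (intro Mu) auto
      then show "\<exists>y. eval D [n] y" ..
    qed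
    obtain c where c: "computes c D [0] 1 2"
      using computableD[OF computable_recf, of "[0]" 2 1 D] by auto
    \<comment> \<open>Acceptance asks for the zero store, so input and output are erased once
      \<open>D\<close> has returned.\<close>
    define diag where "diag = Seq c (clears [0, 1])"
    have "(init n, \<lambda>_. 0) \<in> sem diag \<longleftrightarrow> \<not> P n" for n
    proof -
      have "(init n, t) \<in> sem c \<longleftrightarrow> (\<exists>y. eval D [n] y \<and> t = (init n)(1 := y))" for t
        using computesD[OF c, of "init n" t] by (simp add: init_def)
      moreover have "(\<lambda>j. if j \<in> set [0, 1] then 0 else ((init n)(1 := y)) j) = (\<lambda>_. 0)" for y
        by (auto simp: init_def)
      ultimately show ?thesis
        unfolding diag_def D[symmetric] by (simp only: sem_iffs(1) ex_chain sem_clears simp_thms)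
    qed
    \<comment> \<open>For this code, \<open>P e\<close> holds iff \<open>diag\<close> accepts
      \<open>e\<close>, that is, iff \<open>P e\<close> fails.\<close>
    moreover obtain e where "rules_of e = rules diag"
      using rules_of_surj[OF finite_rules] by blast
    ultimately show False
      using rules_correct[of e diag] unfolding P_def by metis
  qed
  then show ?thesis using fin_gen_simulator by blast
qed

end
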